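(* Let $k\ge 1$ and $r\ge 2$ be integers, let $n_0=kr(k+r-2)+2r-1$, and let $H$ be an $r$-graph consisting of exactly $k$ pairwise disjoint (independent) edges. If $n\ge n_0$, then $$\phi_H^r(n)=\begin{cases}\left\lfloor \frac1k\binom{n}{r}\right\rfloor+k-1, & \text{if } \binom{n}{r}\equiv k-1\pmod k,\\[2pt] \left\lfloor \frac1k\binom{n}{r}\right\rfloor+k-2, & \text{otherwise.}\end{cases}$$ Furthermore, an $r$-graph $G$ on $n$ vertices is an extremal graph of $H$ if and only if either $G\in\mathcal{K}^r_{n,k}$, or $\binom{n}{r}\equiv k-2\pmod k$ and $G=K_n^r$.
   Context: An $r$-graph is an $r$-uniform hypergraph. For $r$-graphs $G$ and $H$, an $H$-decomposition of $G$ is a partition of the edge set $E(G)$ into parts such that each part is either a single edge or its edges form an $r$-graph isomorphic to $H$. $\phi_H^r(G)$ is the minimum number of parts in an $H$-decomposition of $G$, and $\phi_H^r(n)=\max\{\phi_H^r(G): G \text{ an } r\text{-graph on } n \text{ vertices}\}$. An $r$-graph $G$ on $n$ vertices with $\phi_H^r(G)=\phi_H^r(n)$ is called an extremal graph of $H$. $K_n^r$ denotes the complete $r$-graph on $n$ vertices. For positive integers $n\ge r$ and $k$, let $\ell$ be the unique integer with $0\le \ell\le k-1$ such that $\binom{n}{r}-\ell\equiv k-1\pmod k$; $\mathcal{K}^r_{n,k}$ denotes the family of all $r$-graphs obtained from $K_n^r$ by deleting $\ell$ edges. *)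

theory Defs
  imports
    Complex_Main
    "HOL-Library.Disjoint_Sets"
    "HOL-Library.Ramsey"
    "HOL-Number_Theory.Cong"
begin

datatype 'a hypergraph = Hypergraph (verts: "'a set") (edges: "'a set set")

definition r_graph :: "nat \<Rightarrow> 'a hypergraph \<Rightarrow> bool" where
  "r_graph r G \<longleftrightarrow> finite (verts G) \<and> edges G \<subseteq> nsets (verts G) r"

definition hypergraph_iso :: "'a hypergraph \<Rightarrow> 'b hypergraph \<Rightarrow> bool" where
  "hypergraph_iso G H \<longleftrightarrow>
     (\<exists>f. bij_betw f (verts G) (verts H) \<and> edges H = (\<lambda>e. f ` e) ` edges G)"

text \<open>The hypergraph formed by a set \<open>P\<close> of edges has vertex set \<open>\<Union>P\<close>, i.e. no isolated vertices.\<close>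

definition edge_hypergraph :: "'a set set \<Rightarrow> 'a hypergraph" where
  "edge_hypergraph P = Hypergraph (\<Union>P) P"

definition H_decomposition :: "'b hypergraph \<Rightarrow> 'a hypergraph \<Rightarrow> 'a set set set \<Rightarrow> bool" where
  "H_decomposition H G \<P> \<longleftrightarrow>
     partition_on (edges G) \<P> \<and>
     (\<forall>P\<in>\<P>. (\<exists>e. P = {e}) \<or> hypergraph_iso (edge_hypergraph P) H)"

definition phi_graph :: "'b hypergraph \<Rightarrow> 'a hypergraph \<Rightarrow> nat" where
  "phi_graph H G = Min {card \<P> |\<P>. H_decomposition H G \<P>}"

text \<open>Every finite hypergraph has an isomorphic copy with vertices in \<^typ>\<open>nat\<close>, so the maximum over
  all \<open>r\<close>-graphs on \<open>n\<close> vertices is taken over those with natural numbers as vertices.\<close>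

definition phi :: "nat \<Rightarrow> 'b hypergraph \<Rightarrow> nat \<Rightarrow> nat" where
  "phi r H n = Max {phi_graph H G |G :: nat hypergraph. r_graph r G \<and> card (verts G) = n}"

definition extremal_graph :: "nat \<Rightarrow> 'b hypergraph \<Rightarrow> nat \<Rightarrow> 'a hypergraph \<Rightarrow> bool" where
  "extremal_graph r H n G \<longleftrightarrow>
     r_graph r G \<and> card (verts G) = n \<and> phi_graph H G = phi r H n"

definition independent_edges :: "nat \<Rightarrow> nat \<Rightarrow> 'b hypergraph \<Rightarrow> bool" where
  "independent_edges r k H \<longleftrightarrow>
     r_graph r H \<and> verts H = \<Union>(edges H) \<and> card (edges H) = k \<and> disjoint (edges H)"

definition complete_rgraph :: "nat \<Rightarrow> 'a set \<Rightarrow> 'a hypergraph" where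
  "complete_rgraph r V = Hypergraph V (nsets V r)"

text \<open>The congruence is over \<^typ>\<open>int\<close>, since the subtraction on its left may be negative.\<close>

definition deleted_count :: "nat \<Rightarrow> nat \<Rightarrow> nat \<Rightarrow> nat" where
  "deleted_count r n k =
     (THE l. l \<le> k - 1 \<and> [int (n choose r) - int l = int k - 1] (mod int k))"

lemma deleted_count_ex1:
  assumes "k \<ge> 1"
  shows "\<exists>!l. l \<le> k - 1 \<and> [int (n choose r) - int l = int k - 1] (mod int k)"
proof (rule ex1I)
  let ?c = "int (n choose r) + 1"
  have c: "[int (n choose r) - int l = int k - 1] (mod int k) \<longleftrightarrow> [?c = int l] (mod int k)" for l
  proof -
    have "int k dvd (?c - int l - int k) \<longleftrightarrow> int k dvd (?c - int l)"
      using dvd_add_right_iff[of "int k" "- int k" "?c - int l"] by simp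
    then show ?thesis by (simp add: cong_iff_dvd_diff algebra_simps)
  qed
  have pos: "int k > 0" using assms by simp
  show "nat (?c mod int k) \<le> k - 1
      \<and> [int (n choose r) - int (nat (?c mod int k)) = int k - 1] (mod int k)"
    unfolding c using pos pos_mod_bound[OF pos, of ?c] pos_mod_sign[OF pos, of ?c]
    by (auto simp: cong_def nat_le_iff of_nat_diff)
  fix l assume "l \<le> k - 1 \<and> [int (n choose r) - int l = int k - 1] (mod int k)"
  then have "[?c = int l] (mod int k)" "int l < int k" using c assms by auto
  then have "?c mod int k = int l" by (simp add: cong_def)
  then show "l = nat (?c mod int k)" by simp
qed

definition K_family :: "nat \<Rightarrow> nat \<Rightarrow> nat \<Rightarrow> 'a hypergraph set" where
  "K_family r n k =
     {G. \<exists>V D. finite V \<and> card V = n \<and>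
           D \<subseteq> edges (complete_rgraph r V) \<and> card D = deleted_count r n k \<and>
           G = Hypergraph V (edges (complete_rgraph r V) - D)}"

end

theory Submission
  imports Defs "HOL-Combinatorics.Permutations"
begin

text \<open>Let \<open>G\<close> have \<open>m\<close> edges, and let \<open>C\<close> be the number of all \<open>r\<close>-sets. A part of a decomposition
  has 1 or \<open>k\<close> edges, so at least \<open>m div k + m mod k\<close> parts are needed, and the right-hand side of the
  theorem is the maximum of this expression over \<open>m \<le> C\<close>.

  If every edge meets fewer than \<open>m div k\<close> other edges, the Hajnal--Szemeredi theorem, applied to the
  line graph on \<open>k * (m div k)\<close> of the edges, splits these into matchings of size \<open>k\<close>, and the
  bound is attained. Otherwise \<open>m < k r D\<close> with \<open>D = (n - 1 choose (r - 1))\<close>. Take a maximal family of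
  edge-disjoint matchings of size \<open>k\<close>; the set \<open>R\<close> of remaining edges contains no such matching, and
  averaging over the images of \<open>N = n div r\<close> disjoint \<open>r\<close>-sets under all permutations gives
  \<open>N |R| \<le> (k - 1) C\<close>. Since \<open>N D \<le> C\<close> and \<open>N \<ge> k r + (k - 1)\<^sup>2\<close>, the number of parts is at most
  \<open>(m + (k - 1) |R|) / k < C / k\<close>, which is too small for an extremal graph.\<close>

section \<open>The Hajnal--Szemeredi theorem\<close>

text \<open>The obstacle is concentration: the edges through one vertex contain no two disjoint
  ones, so for a graph with few edges the number of edges alone does not determine how many copies
  of \<open>H\<close> can be packed. The extremal value \<open>T\<close> satisfies
  \<open>C \<le> k * T\<close>, so the crude strict bound \<open>k * phi_graph H G < C\<close>
  already excludes the graph. The two cases can be separated by degrees in the line graph because an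
  edge meets at most \<open>r * (D - 1)\<close> others, however many edges there are; a violated
  degree condition therefore forces the graph to be sparse. In the dense case every class must have
  exactly \<open>k\<close> members, which an ordinary greedy colouring does not provide; hence
  equitable colourings. The threshold comes from the sparse case: multiplied by \<open>N\<close>,
  the bound there has the factor \<open>k * r + (k - 1)^2\<close> in front of \<open>C\<close>, and
  the threshold equals \<open>r * (k * r + (k - 1)^2) + r - 1\<close>, whose quotient by
  \<open>r\<close> is this factor.\<close>

text \<open>The proof is the one of Kierstead and Kostochka. In a nearly equitable colouring, colour \<open>a\<close>
  has one vertex too few and colour \<open>b\<close> one too many. The colours form a digraph with an arc from \<open>c\<close>
  to \<open>d\<close> if some vertex of colour \<open>c\<close> can be recoloured \<open>d\<close>; moving one vertex along each arc of a path
  from \<open>b\<close> to \<open>a\<close> makes the colouring equitable.\<close>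

locale loopless_graph =
  fixes E :: "'v \<Rightarrow> 'v \<Rightarrow> bool"
  assumes sym: "E u v \<Longrightarrow> E v u" and irrefl: "\<not> E v v"
begin

definition proper :: "'v set \<Rightarrow> ('v \<Rightarrow> 'c) \<Rightarrow> bool" where
  "proper V f \<longleftrightarrow> (\<forall>u\<in>V. \<forall>v\<in>V. E u v \<longrightarrow> f u \<noteq> f v)"

definition colour_class :: "'v set \<Rightarrow> ('v \<Rightarrow> 'c) \<Rightarrow> 'c \<Rightarrow> 'v set" where
  "colour_class V f c = {v\<in>V. f v = c}"

definition neighbours :: "'v set \<Rightarrow> 'v \<Rightarrow> 'v set" where
  "neighbours V v = {u\<in>V. E v u}"

definition equitable :: "'v set \<Rightarrow> 'c set \<Rightarrow> nat \<Rightarrow> ('v \<Rightarrow> 'c) \<Rightarrow> bool" where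
  "equitable V C k f \<longleftrightarrow> f ` V \<subseteq> C \<and> proper V f \<and> (\<forall>c\<in>C. card (colour_class V f c) = k)"

definition movable :: "'v set \<Rightarrow> ('v \<Rightarrow> 'c) \<Rightarrow> 'v \<Rightarrow> 'c \<Rightarrow> bool" where
  "movable V f y c \<longleftrightarrow> (\<forall>u\<in>V. E y u \<longrightarrow> f u \<noteq> c)"

definition arc :: "'v set \<Rightarrow> ('v \<Rightarrow> 'c) \<Rightarrow> 'c \<Rightarrow> 'c \<Rightarrow> bool" where
  "arc V f c d \<longleftrightarrow> (\<exists>y\<in>V. f y = c \<and> movable V f y d)"

text \<open>Deleting each colour once it is left keeps the colours of a path distinct, so a shift
  along it uses every class at most once as a source and once as a target. Varying \<open>S\<close>
  expresses that a path avoids a colour.\<close>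

inductive simple_path :: "'v set \<Rightarrow> ('v \<Rightarrow> 'c) \<Rightarrow> 'c \<Rightarrow> 'c set \<Rightarrow> 'c \<Rightarrow> bool" for V f a where
  base: "a \<in> S \<Longrightarrow> simple_path V f a S a"
| step: "c \<in> S \<Longrightarrow> arc V f c d \<Longrightarrow> simple_path V f a (S - {c}) d \<Longrightarrow> simple_path V f a S c"

lemma simple_path_mem:
  assumes "simple_path V f a S c"
  shows "c \<in> S" "a \<in> S"
  using assms by (induction rule: simple_path.induct) auto

lemma simple_path_mono:
  assumes "simple_path V f a S c" "S \<subseteq> S'"
  shows "simple_path V f a S' c"
  using assms
proof (induction arbitrary: S' rule: simple_path.induct)
  case (base S)
  then show ?case by (auto intro: simple_path.base)
next
  case (step c S d)
  have "simple_path V f a (S' - {c}) d" using step.IH[of "S' - {c}"] step.prems by blast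
  then show ?case using step by (blast intro: simple_path.step)
qed

text \<open>If the path from \<open>d\<close> runs through \<open>c\<close>, its tail from
  \<open>c\<close> never returns to \<open>d\<close>. This serves both to prepend an arc without
  creating a loop and to compare paths around two colours.\<close>

lemma simple_path_avoids:
  assumes "simple_path V f a S d" "c \<noteq> d"
  shows "simple_path V f a (S - {c}) d \<or> simple_path V f a (S - {d}) c"
  using assms
proof (induction arbitrary: c rule: simple_path.induct)
  case (base S)
  then show ?case by (auto intro: simple_path.base)
next
  case (step d S d')
  show ?case
  proof (cases "c = d'")
    case True
    then show ?thesis using step.hyps by simp
  next
    case False
    from step.IH[OF False] show ?thesis
    proof
      assume "simple_path V f a (S - {d} - {c}) d'"
      moreover have "S - {d} - {c} = S - {c} - {d}" by blast
      ultimately have "simple_path V f a (S - {c} - {d}) d'" by simp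
      then have "simple_path V f a (S - {c}) d"
        using step.hyps step.prems by (intro simple_path.step[of d _ _ _ d']) auto
      then show ?thesis ..
    next
      assume "simple_path V f a (S - {d} - {d'}) c"
      then have "simple_path V f a (S - {d}) c" by (rule simple_path_mono) auto
      then show ?thesis ..
    qed
  qed
qed

lemma simple_path_arc:
  assumes "simple_path V f a S d" "arc V f c d" "c \<in> S"
  shows "simple_path V f a S c"
proof (cases "c = d")
  case False
  from simple_path_avoids[OF assms(1) False] show ?thesis
  proof
    assume "simple_path V f a (S - {c}) d"
    then show ?thesis using assms by (blast intro: simple_path.step)
  next
    assume "simple_path V f a (S - {d}) c"
    then show ?thesis by (rule simple_path_mono) auto
  qed
qed (use assms in auto)

definition accessible :: "'v set \<Rightarrow> ('v \<Rightarrow> 'c) \<Rightarrow> 'c set \<Rightarrow> 'c \<Rightarrow> 'c set" where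
  "accessible V f C a = {c. simple_path V f a C c}"

text \<open>Every colour on a path to \<open>a\<close> is itself accessible, so a shift along the
  path recolours no vertex of an inaccessible class.\<close>

lemma simple_path_accessible:
  assumes "simple_path V f a S c" "S \<subseteq> C"
  shows "simple_path V f a (S \<inter> accessible V f C a) c"
  using assms
proof (induction rule: simple_path.induct)
  case (base S)
  then show ?case by (auto intro: simple_path.base simp: accessible_def)
next
  case (step c S d)
  have "simple_path V f a S c" using step.hyps by (rule simple_path.step)
  then have "c \<in> accessible V f C a"
    using simple_path_mono step.prems unfolding accessible_def by auto
  moreover have "simple_path V f a ((S \<inter> accessible V f C a) - {c}) d"
  proof -
    have "(S - {c}) \<inter> accessible V f C a = (S \<inter> accessible V f C a) - {c}" by blast
    then show ?thesis using step.IH step.prems by auto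
  qed
  ultimately show ?case using step.hyps by (blast intro: simple_path.step)
qed

section \<open>Recolouring and its effect on class sizes\<close>

lemma card_colour_class_update:
  assumes "finite V" "y \<in> V" "c \<noteq> d" "g y = c"
  shows "card (colour_class V (g(y := d)) x) + of_bool (x = c) = card (colour_class V g x) + of_bool (x = d)"
proof -
  have fin: "finite (colour_class V h x)" for h
    using assms(1) by (simp add: colour_class_def)
  consider "x = c" | "x = d" | "x \<noteq> c" "x \<noteq> d" by blast
  then show ?thesis
  proof cases
    case 1
    have "colour_class V g x = insert y (colour_class V (g(y := d)) x)"
      "y \<notin> colour_class V (g(y := d)) x"
      using assms 1 by (auto simp: colour_class_def)
    then show ?thesis using assms 1 fin by simp
  next
    case 2
    have "colour_class V (g(y := d)) x = insert y (colour_class V g x)" "y \<notin> colour_class V g x"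
      using assms 2 by (auto simp: colour_class_def)
    then show ?thesis using assms 2 fin by simp
  next
    case 3
    have "colour_class V (g(y := d)) x = colour_class V g x"
      using assms 3 by (auto simp: colour_class_def)
    then show ?thesis using 3 by simp
  qed
qed

lemma proper_update:
  assumes "proper V g" "movable V g y d"
  shows "proper V (g(y := d))"
  unfolding proper_def
proof (intro ballI impI)
  fix u v assume *: "u \<in> V" "v \<in> V" "E u v"
  then have "u \<noteq> v" "E v u" using sym irrefl by auto
  then show "(g(y := d)) u \<noteq> (g(y := d)) v"
    using * assms unfolding proper_def movable_def by (cases "u = y"; cases "v = y") auto
qed

text \<open>The tail of the path is shifted before its first arc. The clause on
  \<open>colour_class V g c\<close> drives the induction: the class where the tail starts has only
  lost vertices, so a vertex that could move there under \<open>f\<close> still can. Indicators on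
  both sides avoid subtraction and cover the trivial path \<open>c = a\<close>.\<close>

lemma shift_along_path:
  assumes "simple_path V f a S c" "finite V" "proper V f"
  shows "\<exists>g. proper V g \<and> (\<forall>v\<in>V. f v \<notin> S \<longrightarrow> g v = f v) \<and> (\<forall>v\<in>V. f v \<in> S \<longrightarrow> g v \<in> S)
    \<and> colour_class V g c \<subseteq> colour_class V f c
    \<and> (\<forall>x. card (colour_class V g x) + of_bool (x = c) = card (colour_class V f x) + of_bool (x = a))"
  using assms
proof (induction rule: simple_path.induct)
  case (base S)
  then show ?case by (intro exI[of _ f]) auto
next
  case (step c S d)
  then obtain g where g: "proper V g" "\<And>v. v \<in> V \<Longrightarrow> f v \<notin> S - {c} \<Longrightarrow> g v = f v"
    "\<And>v. v \<in> V \<Longrightarrow> f v \<in> S - {c} \<Longrightarrow> g v \<in> S - {c}"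
    "colour_class V g d \<subseteq> colour_class V f d"
    "\<And>x. card (colour_class V g x) + of_bool (x = d) = card (colour_class V f x) + of_bool (x = a)"
    by metis
  obtain y where y: "y \<in> V" "f y = c" "movable V f y d" using step.hyps by (auto simp: arc_def)
  have d: "d \<in> S - {c}" using simple_path_mem(1)[OF step.hyps(3)] .
  have gy: "g y = c" using g(2) y by auto
  have "movable V g y d"
    using y g(4) unfolding movable_def colour_class_def by blast
  then have 1: "proper V (g(y := d))" using g(1) by (intro proper_update)
  have 2: "card (colour_class V (g(y := d)) x) + of_bool (x = c)
      = card (colour_class V f x) + of_bool (x = a)" for x
    using card_colour_class_update[of V y c d g x] g(5)[of x] d y gy step.prems by auto
  have 3: "colour_class V (g(y := d)) c \<subseteq> colour_class V f c"
  proof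
    fix v assume "v \<in> colour_class V (g(y := d)) c"
    then have v: "v \<in> V" "g v = c" using d by (auto simp: colour_class_def split: if_splits)
    then have "f v \<notin> S - {c}" using g(3) by blast
    then show "v \<in> colour_class V f c" using g(2) v by (simp add: colour_class_def)
  qed
  have 4: "(g(y := d)) v = f v" if "v \<in> V" "f v \<notin> S" for v
    using that g(2) y step.hyps by auto
  have 5: "(g(y := d)) v \<in> S" if "v \<in> V" "f v \<in> S" for v
    using that g(2,3) d by (cases "f v = c") auto
  show ?case using 1 2 3 4 5 by (intro exI[of _ "g(y := d)"]) blast
qed

section \<open>Double counting and independent sets\<close>

lemma sum_card_edges:
  assumes "finite X" "finite Y"
  shows "(\<Sum>x\<in>X. w x * card {y\<in>Y. E x y}) = (\<Sum>y\<in>Y. \<Sum>x | x \<in> X \<and> E y x. w x)"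
proof -
  have "(\<Sum>x\<in>X. w x * card {y\<in>Y. E x y}) = (\<Sum>x\<in>X. \<Sum>y\<in>Y. if E x y then w x else 0)"
    using assms by (simp add: sum.If_cases Int_def mult.commute)
  also have "\<dots> = (\<Sum>y\<in>Y. \<Sum>x\<in>X. if E x y then w x else 0)" by (rule sum.swap)
  also have "\<dots> = (\<Sum>y\<in>Y. \<Sum>x\<in>X. if E y x then w x else 0)"
    by (intro sum.cong refl) (metis sym)
  also have "\<dots> = (\<Sum>y\<in>Y. \<Sum>x | x \<in> X \<and> E y x. w x)"
    using assms by (simp add: sum.If_cases Int_def)
  finally show ?thesis .
qed

text \<open>The closed neighbourhoods of a maximal independent set cover \<open>B\<close>.\<close>

lemma exists_dominating_independent_set:
  assumes "finite B"
  obtains I where "I \<subseteq> B" "\<And>u v. u \<in> I \<Longrightarrow> v \<in> I \<Longrightarrow> \<not> E u v"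
    "card B \<le> (\<Sum>y\<in>I. card (neighbours B y) + 1)"
proof -
  let ?F = "{I. I \<subseteq> B \<and> (\<forall>u\<in>I. \<forall>v\<in>I. \<not> E u v)}"
  have "finite ?F" "{} \<in> ?F" using assms by auto
  then obtain I where I: "I \<in> ?F" "\<And>J. J \<in> ?F \<Longrightarrow> I \<subseteq> J \<Longrightarrow> J = I"
    using finite_has_maximal2[of ?F "{}"] by (metis (no_types, lifting))
  have finI: "finite I" using I(1) assms finite_subset by auto
  have "B \<subseteq> (\<Union>y\<in>I. insert y (neighbours B y))"
  proof
    fix v assume v: "v \<in> B"
    show "v \<in> (\<Union>y\<in>I. insert y (neighbours B y))"
    proof (rule ccontr)
      assume n: "\<not> ?thesis"
      then have "\<not> E y v" if "y \<in> I" for y using that v by (auto simp: neighbours_def)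
      then have "insert v I \<in> ?F" using I(1) v sym irrefl by blast
      then have "insert v I = I" using I(2) by blast
      then show False using n by blast
    qed
  qed
  then have "card B \<le> card (\<Union>y\<in>I. insert y (neighbours B y))"
    using finI assms by (intro card_mono) (auto simp: neighbours_def)
  also have "\<dots> \<le> (\<Sum>y\<in>I. card (insert y (neighbours B y)))" using finI by (rule card_UN_le)
  also have "\<dots> \<le> (\<Sum>y\<in>I. card (neighbours B y) + 1)"
    using assms by (intro sum_mono) (simp add: card_insert_if neighbours_def)
  finally show ?thesis using I(1) that by auto
qed

end

text \<open>The assumption \<open>smaller\<close> is the Hajnal--Szemeredi theorem for fewer
  colours. It carries the induction hypothesis into the locale, where it recolours the inaccessible
  vertices.\<close>

locale nearly_equitable = loopless_graph E for E :: "'v \<Rightarrow> 'v \<Rightarrow> bool" +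
  fixes V :: "'v set" and C :: "'c set" and k :: nat and f :: "'v \<Rightarrow> 'c" and a b :: 'c
  assumes finV: "finite V" and finC: "finite C"
    and ab: "a \<in> C" "b \<in> C" "a \<noteq> b"
    and f_into: "f ` V \<subseteq> C" and f_proper: "proper V f"
    and sizes: "c \<in> C \<Longrightarrow> card (colour_class V f c) + of_bool (c = a) = k + of_bool (c = b)"
    and deg: "v \<in> V \<Longrightarrow> card (neighbours V v) < card C"
    and smaller: "C' \<subset> C \<Longrightarrow> V' \<subseteq> V \<Longrightarrow> card V' = k * card C' \<Longrightarrow>
      (\<And>v. v \<in> V' \<Longrightarrow> card (neighbours V' v) < card C') \<Longrightarrow> \<exists>g. equitable V' C' k g"
begin

section \<open>Accessible colours and the vertices outside them\<close>

abbreviation A where "A \<equiv> accessible V f C a"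

abbreviation B where "B \<equiv> {v\<in>V. f v \<notin> A}"

abbreviation degree_in :: "'v \<Rightarrow> 'c \<Rightarrow> nat" where
  "degree_in v c \<equiv> card {u\<in>V. E v u \<and> f u = c}"

lemma A_subset: "A \<subseteq> C"
  using simple_path_mem(1) by (auto simp: accessible_def)

lemma a_in_A: "a \<in> A"
  using ab by (auto simp: accessible_def intro: simple_path.base)

lemma finA: "finite A" using A_subset finC finite_subset by auto

lemma card_colours: "card C = card A + card (C - A)"
  using A_subset finA card_Diff_subset[of A C] card_mono[OF finC A_subset] by auto

lemma sum_degree_in:
  assumes "D \<subseteq> C"
  shows "(\<Sum>c\<in>D. degree_in v c) = card {u\<in>V. E v u \<and> f u \<in> D}"
proof -
  have "(\<Sum>c\<in>D. \<Sum>u | u \<in> {u\<in>V. E v u \<and> f u \<in> D} \<and> f u = c. 1) = (\<Sum>u | u \<in> V \<and> E v u \<and> f u \<in> D. (1::nat))"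
    using finV finC assms finite_subset by (intro sum.group) auto
  moreover have "(\<Sum>u | u \<in> {u\<in>V. E v u \<and> f u \<in> D} \<and> f u = c. (1::nat)) = degree_in v c" if "c \<in> D" for c
    using that by (auto intro: arg_cong[where f = card])
  ultimately show ?thesis by simp
qed

lemma degree_in_B: "card (neighbours B v) = (\<Sum>c\<in>C - A. degree_in v c)"
proof -
  have "neighbours B v = {u\<in>V. E v u \<and> f u \<in> C - A}" using f_into by (auto simp: neighbours_def)
  then show ?thesis using sum_degree_in[of "C - A"] by auto
qed

lemma degree_split:
  assumes "v \<in> V"
  shows "(\<Sum>c\<in>A. degree_in v c) + card (neighbours B v) < card A + card (C - A)"
proof -
  have "(\<Sum>c\<in>A. degree_in v c) + (\<Sum>c\<in>C - A. degree_in v c) = (\<Sum>c\<in>C. degree_in v c)"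
    using sum.subset_diff[OF A_subset finC, of "degree_in v"] by (simp only: add.commute)
  also have "\<dots> = card (neighbours V v)"
  proof -
    have "{u\<in>V. E v u \<and> f u \<in> C} = neighbours V v" using f_into by (auto simp: neighbours_def)
    then show ?thesis using sum_degree_in[of C v] by simp
  qed
  finally show ?thesis using deg[OF assms] degree_in_B card_colours by simp
qed

lemma not_movable_degree:
  assumes "\<not> movable V f v c"
  shows "1 \<le> degree_in v c"
proof -
  have "{u\<in>V. E v u \<and> f u = c} \<noteq> {}" "finite {u\<in>V. E v u \<and> f u = c}"
    using assms finV by (auto simp: movable_def)
  then show ?thesis by (metis One_nat_def Suc_leI card_gt_0_iff)
qed

lemma B_not_movable:
  assumes "y \<in> B" "c \<in> A"
  shows "\<not> movable V f y c"
proof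
  assume "movable V f y c"
  then have "arc V f (f y) c" using assms by (auto simp: arc_def)
  then have "f y \<in> A"
    using assms f_into simple_path_arc[of V f a C c "f y"] by (auto simp: accessible_def)
  then show False using assms by auto
qed

lemma degree_in_A_ge:
  assumes "D \<subseteq> A" "\<And>c. c \<in> D \<Longrightarrow> \<not> movable V f v c"
  shows "card D \<le> (\<Sum>c\<in>A. degree_in v c)"
proof -
  have "card D \<le> (\<Sum>c\<in>D. degree_in v c)"
    using sum_mono[of D "\<lambda>_. 1" "degree_in v"] not_movable_degree assms by simp
  also have "\<dots> \<le> (\<Sum>c\<in>A. degree_in v c)"
    using assms finA by (intro sum_mono2) auto
  finally show ?thesis .
qed

text \<open>One neighbour in each class of \<open>A\<close> uses up \<open>card A\<close> of the
  degree. What remains satisfies the degree condition for colouring \<open>B\<close> with the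
  colours \<open>C - A\<close> only.\<close>

lemma degree_B:
  assumes "y \<in> B"
  shows "card (neighbours B y) < card (C - A)"
  using degree_in_A_ge[of A y] B_not_movable[OF assms] degree_split[of y] assms by auto

lemma card_colours_union:
  assumes "D \<subseteq> C"
  shows "card {v\<in>V. f v \<in> D} = (\<Sum>c\<in>D. card (colour_class V f c))"
proof -
  have "(\<Sum>c\<in>D. \<Sum>u | u \<in> {v\<in>V. f v \<in> D} \<and> f u = c. 1) = (\<Sum>u | u \<in> V \<and> f u \<in> D. (1::nat))"
    using finV finC assms finite_subset by (intro sum.group) auto
  moreover have "(\<Sum>u | u \<in> {v\<in>V. f v \<in> D} \<and> f u = c. (1::nat)) = card (colour_class V f c)" if "c \<in> D" for c
    using that by (auto simp: colour_class_def intro: arg_cong[where f = card])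
  ultimately show ?thesis by simp
qed

lemma equitable_if_accessible:
  assumes "b \<in> A"
  shows "\<exists>g. equitable V C k g"
proof -
  have "simple_path V f a C b" using assms by (simp add: accessible_def)
  from shift_along_path[OF this finV f_proper] obtain g where g: "proper V g"
    "\<And>v. v \<in> V \<Longrightarrow> f v \<in> C \<Longrightarrow> g v \<in> C"
    "\<And>x. card (colour_class V g x) + of_bool (x = b) = card (colour_class V f x) + of_bool (x = a)"
    by blast
  have "card (colour_class V g c) = k" if "c \<in> C" for c
    using g(3)[of c] sizes[OF that] by simp
  then show ?thesis using g f_into unfolding equitable_def by blast
qed

text \<open>The extra vertex is the surplus of class \<open>b\<close>, while the short class
  \<open>a\<close> lies in \<open>A\<close>. Deleting any one vertex of \<open>B\<close> thus gives
  the size that the induction hypothesis requires.\<close>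

lemma card_B:
  assumes "b \<notin> A"
  shows "card B = k * card (C - A) + 1"
proof -
  have "B = {v\<in>V. f v \<in> C - A}" using f_into by auto
  then have "card B = (\<Sum>c\<in>C - A. card (colour_class V f c))" using card_colours_union[of "C - A"] by simp
  also have "\<dots> = (\<Sum>c\<in>C - A. k + of_bool (c = b))"
  proof (intro sum.cong refl)
    fix c assume "c \<in> C - A"
    then show "card (colour_class V f c) = k + of_bool (c = b)"
      using sizes[of c] a_in_A by (cases "c = a") auto
  qed
  also have "\<dots> = k * card (C - A) + (\<Sum>c\<in>C - A. of_bool (c = b))"
    by (simp add: sum.distrib mult.commute)
  also have "(\<Sum>c\<in>C - A. of_bool (c = b)) = (1::nat)"
    using assms ab finC by (simp add: of_bool_def sum.delta)
  finally show ?thesis .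
qed

lemma equitable_B_minus:
  assumes "b \<notin> A" "y \<in> B"
  shows "\<exists>g. equitable (B - {y}) (C - A) k g"
proof (rule smaller)
  show "C - A \<subset> C" using a_in_A ab by auto
  show "B - {y} \<subseteq> V" by auto
  show "card (B - {y}) = k * card (C - A)" using card_B assms finV by simp
  fix v assume v: "v \<in> B - {y}"
  have "card (neighbours (B - {y}) v) \<le> card (neighbours B v)"
    using finV by (intro card_mono) (auto simp: neighbours_def)
  then show "card (neighbours (B - {y}) v) < card (C - A)" using degree_B[of v] v by auto
qed

text \<open>A solo edge in the sense of Kierstead and Kostochka: \<open>z\<close> alone keeps
  \<open>y\<close> from taking the colour of \<open>z\<close>.\<close>

definition solo :: "'v \<Rightarrow> 'v \<Rightarrow> bool" where
  "solo y z \<longleftrightarrow> {u\<in>V. E y u \<and> f u = f z} = {z}"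

lemma soloD:
  assumes "solo y z"
  shows "z \<in> V" "E y z" "\<And>u. u \<in> V \<Longrightarrow> E y u \<Longrightarrow> f u = f z \<Longrightarrow> u = z"
proof -
  have "z \<in> {u\<in>V. E y u \<and> f u = f z}" using assms by (simp add: solo_def)
  then show "z \<in> V" "E y z" by auto
  fix u assume "u \<in> V" "E y u" "f u = f z"
  then have "u \<in> {u\<in>V. E y u \<and> f u = f z}" by simp
  then have "u \<in> {z}" using assms unfolding solo_def by (simp only:)
  then show "u = z" by simp
qed

text \<open>Move \<open>z\<close> to \<open>x\<close> and shift along the path from \<open>x\<close> to \<open>a\<close>; then \<open>y\<close> fits into the old class of \<open>z\<close>,
  and \<open>B - {y}\<close> is recoloured by induction.\<close>

lemma equitable_if_solo_movable:
  assumes "b \<notin> A" "f z \<in> A" "simple_path V f a (C - {f z}) x" "movable V f z x"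
    "y \<in> B" "solo y z"
  shows "\<exists>g. equitable V C k g"
proof -
  \<comment> \<open>Leaving out \<open>f z\<close> protects the class that is to receive
    \<open>y\<close>; intersecting with \<open>A\<close> protects \<open>B\<close>.\<close>
  let ?S = "(C - {f z}) \<inter> A"
  have "simple_path V f a ?S x" using assms(3) by (rule simple_path_accessible) auto
  from shift_along_path[OF this finV f_proper] obtain g where g: "proper V g"
    "\<And>v. v \<in> V \<Longrightarrow> f v \<notin> ?S \<Longrightarrow> g v = f v"
    "\<And>v. v \<in> V \<Longrightarrow> f v \<in> ?S \<Longrightarrow> g v \<in> ?S"
    "colour_class V g x \<subseteq> colour_class V f x"
    "\<And>c. card (colour_class V g c) + of_bool (c = x) = card (colour_class V f c) + of_bool (c = a)"
    by blast
  have x: "x \<in> ?S" using \<open>simple_path V f a ?S x\<close> by (rule simple_path_mem)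
  note z = soloD[OF assms(6)]
  have yV: "y \<in> V" "f y \<in> C" "f y \<notin> A" using assms(5) f_into by auto
  have gz: "g z = f z" and gy: "g y = f y" using g(2) z yV by auto
  have yz: "y \<noteq> z" using irrefl z by auto
  obtain p where p: "equitable (B - {y}) (C - A) k p" using equitable_B_minus assms by blast
  define h where "h = (g(z := x))(y := f z)"
  have "movable V g z x" using assms(4) g(4) unfolding movable_def colour_class_def by blast
  then have 1: "proper V (g(z := x))" using g(1) by (intro proper_update)
  have "movable V (g(z := x)) y (f z)"
    unfolding movable_def
  proof (intro ballI impI)
    fix u assume u: "u \<in> V" "E y u"
    show "(g(z := x)) u \<noteq> f z"
    proof (cases "u = z")
      case True
      then show ?thesis using x by auto
    next
      case False
      then have "f u \<noteq> f z" using z u by blast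
      then show ?thesis using False g(2,3) u by (cases "f u \<in> ?S") auto
    qed
  qed
  then have h_proper: "proper V h" unfolding h_def using 1 by (rule proper_update[rotated])
  have h_size: "card (colour_class V h c) = k" if "c \<in> A" for c
  proof -
    have "card (colour_class V (g(z := x)) c) + of_bool (c = f z) = card (colour_class V g c) + of_bool (c = x)"
      using x z gz finV by (intro card_colour_class_update) auto
    moreover have "card (colour_class V h c) + of_bool (c = f y) = card (colour_class V (g(z := x)) c) + of_bool (c = f z)"
      unfolding h_def using yV assms(2) gy yz finV by (intro card_colour_class_update) auto
    moreover have "c \<noteq> f y" "c \<noteq> b" "c \<in> C" using that yV assms(1) A_subset by auto
    ultimately show ?thesis using g(5)[of c] sizes[of c] by simp
  qed
  \<comment> \<open>Outside \<open>B - {y}\<close> the colouring \<open>h\<close> uses only colours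
    of \<open>A\<close>, while \<open>p\<close> uses only colours of \<open>C - A\<close>, so gluing
    them creates no conflict between the two parts.\<close>
  have hA: "h v \<in> A \<longleftrightarrow> v \<notin> B - {y}" if "v \<in> V" for v
    using that g(2,3)[OF that] assms(2) x unfolding h_def by (cases "f v \<in> ?S") auto
  define F where "F v = (if v \<in> B - {y} then p v else h v)" for v
  have pB: "p v \<in> C - A" if "v \<in> B - {y}" for v using p that unfolding equitable_def by blast
  have "proper V F"
    unfolding proper_def
  proof (intro ballI impI)
    fix u v assume uv: "u \<in> V" "v \<in> V" "E u v"
    consider "u \<in> B - {y}" "v \<in> B - {y}" | "u \<notin> B - {y}" "v \<notin> B - {y}"
      | "u \<in> B - {y}" "v \<notin> B - {y}" | "u \<notin> B - {y}" "v \<in> B - {y}" by blast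
    then show "F u \<noteq> F v"
    proof cases
      case 1
      then show ?thesis using p uv unfolding equitable_def proper_def F_def by auto
    next
      case 2
      then have "F u = h u" "F v = h v" by (simp_all only: F_def if_False)
      then show ?thesis using h_proper uv unfolding proper_def by auto
    next
      case 3
      then have "F u \<notin> A" "F v \<in> A" using pB hA uv unfolding F_def by auto
      then show ?thesis by auto
    next
      case 4
      then have "F v \<notin> A" "F u \<in> A" using pB hA uv unfolding F_def by auto
      then show ?thesis by auto
    qed
  qed
  moreover have "F ` V \<subseteq> C" using pB hA A_subset unfolding F_def by auto
  moreover have "card (colour_class V F c) = k" if "c \<in> C" for c
  proof (cases "c \<in> A")
    case True
    then have "colour_class V F c = colour_class V h c"
      using pB hA unfolding F_def colour_class_def by auto
    then show ?thesis using h_size True by simp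
  next
    case False
    then have "h v \<noteq> c" if "v \<in> V" "v \<notin> B - {y}" for v using hA[OF that(1)] that(2) by blast
    then have "colour_class V F c = colour_class (B - {y}) p c"
      unfolding F_def colour_class_def by auto
    then show ?thesis using p False that unfolding equitable_def by auto
  qed
  ultimately show ?thesis unfolding equitable_def by blast
qed

end

section \<open>Enlarging the accessible set by a swap\<close>

context loopless_graph
begin

lemma movable_iff: "movable V f y c \<longleftrightarrow> (\<forall>u\<in>colour_class V f c. \<not> E y u)"
  by (auto simp: movable_def colour_class_def)

lemma arc_iff: "arc V f c d \<longleftrightarrow> (\<exists>y\<in>colour_class V f c. movable V f y d)"
  by (auto simp: arc_def colour_class_def)

lemma simple_path_cong:
  assumes "simple_path V f a S c" "\<And>c. c \<in> S \<Longrightarrow> colour_class V g c = colour_class V f c"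
  shows "simple_path V g a S c"
  using assms
proof (induction rule: simple_path.induct)
  case (base S)
  then show ?case by (auto intro: simple_path.base)
next
  case (step c S d)
  have "d \<in> S" using simple_path_mem(1)[OF step.hyps(3)] by simp
  then have "arc V g c d" using step.hyps step.prems by (simp add: arc_iff movable_iff)
  then show ?case using step by (intro simple_path.step[of c S _ _ d]) auto
qed

end

context nearly_equitable
begin

text \<open>Recolour \<open>B - {y}\<close> by induction, give \<open>y\<close> the colour of \<open>z\<close> and put \<open>z\<close> into a class of \<open>B\<close>; now \<open>y'\<close> is
  movable to the old class of \<open>z\<close>, so its colour has become accessible.\<close>

lemma swap_enlarges_accessible:
  assumes bA: "b \<notin> A" and zA: "f z \<in> A" "f z \<noteq> a"
    and terminal: "\<And>c. c \<in> A - {f z} \<Longrightarrow> simple_path V f a (C - {f z}) c"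
    and stuck: "\<And>c. c \<in> A - {f z} \<Longrightarrow> \<not> movable V f z c"
    and y: "y \<in> B" "y' \<in> B" "y \<noteq> y'" "\<not> E y y'" "solo y z" "solo y' z"
  shows "\<exists>g b'. nearly_equitable E V C k g a b' \<and> A \<subset> accessible V g C a"
proof -
  note z = soloD[OF y(5)] and z' = soloD[OF y(6)]
  obtain p where p: "equitable (B - {y}) (C - A) k p" using equitable_B_minus bA y(1) by blast
  have pB: "p v \<in> C - A" if "v \<in> B - {y}" for v using p that unfolding equitable_def by blast
  have zB: "z \<notin> B" using zA by auto
  \<comment> \<open>Being stuck, \<open>z\<close> has a neighbour in each of the other
    \<open>card A - 1\<close> classes of \<open>A\<close>, hence at most \<open>card (C - A)\<close>
    in \<open>B\<close>. One of these is \<open>y\<close>, so \<open>p\<close> omits some colour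
    \<open>b'\<close> among the neighbours of \<open>z\<close> in \<open>B - {y}\<close>; it becomes
    the new surplus colour.\<close>
  have "card (neighbours B z) \<le> card (C - A)"
    using degree_in_A_ge[of "A - {f z}" z] stuck degree_split[OF z(1)] zA finA by auto
  moreover have "neighbours (B - {y}) z = neighbours B z - {y}" "y \<in> neighbours B z"
    using y(1) z(2) sym by (auto simp: neighbours_def)
  moreover have finN: "finite (neighbours B z)" using finV by (simp add: neighbours_def)
  ultimately have "card (neighbours (B - {y}) z) < card (C - A)"
    using card_Diff1_less[of "neighbours B z" y] by simp
  moreover have "card (p ` neighbours (B - {y}) z) \<le> card (neighbours (B - {y}) z)"
    using finV by (intro card_image_le) (simp add: neighbours_def)
  ultimately have "\<not> C - A \<subseteq> p ` neighbours (B - {y}) z"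
    using card_mono[of "p ` neighbours (B - {y}) z" "C - A"] finV by (auto simp: neighbours_def)
  then obtain b' where b': "b' \<in> C - A" "b' \<notin> p ` neighbours (B - {y}) z" by blast
  define F where "F v = (if v = y then f z else if v = z then b' else if v \<in> B then p v else f v)" for v
  have yz: "y \<noteq> z" using zB y(1) by auto
  have F_simps: "F y = f z" "F z = b'" "\<And>v. v \<in> B - {y} \<Longrightarrow> F v = p v"
    "\<And>v. v \<in> V \<Longrightarrow> f v \<in> A \<Longrightarrow> v \<noteq> z \<Longrightarrow> F v = f v"
    using yz zB y(1) unfolding F_def by auto
  have FA: "F v \<in> A \<longleftrightarrow> v \<notin> B - {y} \<and> v \<noteq> z" if "v \<in> V" for v
  proof -
    consider "v = y" | "v = z" | "v \<in> B - {y}" | "f v \<in> A" "v \<noteq> z" using \<open>v \<in> V\<close> by blast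
    then show ?thesis
    proof cases
      case 3
      then have "F v \<notin> A" using pB F_simps(3) by auto
      then show ?thesis using 3 by blast
    next
      case 4
      then show ?thesis using F_simps(4)[OF that] by auto
    qed (use F_simps yz zA b' in auto)
  qed
  have class_other: "colour_class V F c = colour_class V f c" if "c \<in> A - {f z}" for c
  proof (rule set_eqI)
    fix v
    show "v \<in> colour_class V F c \<longleftrightarrow> v \<in> colour_class V f c"
    proof (cases "v \<in> V \<and> f v \<in> A \<and> v \<noteq> z")
      case True
      then show ?thesis using F_simps(4) by (auto simp: colour_class_def)
    next
      case False
      moreover have "F v \<noteq> c" if "v \<in> V"
        using False FA[OF that] \<open>c \<in> A - {f z}\<close> F_simps(1) that by (cases "v = y") auto
      ultimately show ?thesis using that by (auto simp: colour_class_def)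
    qed
  qed
  have class_W: "colour_class V F (f z) = insert y (colour_class V f (f z) - {z})"
  proof (rule set_eqI)
    fix v
    show "v \<in> colour_class V F (f z) \<longleftrightarrow> v \<in> insert y (colour_class V f (f z) - {z})"
    proof (cases "v \<in> V \<and> f v \<in> A \<and> v \<noteq> z")
      case True
      then show ?thesis using F_simps(4) y(1) by (auto simp: colour_class_def)
    next
      case False
      moreover have "F v \<noteq> f z" if "v \<in> V" "v \<noteq> y"
        using False FA[OF that(1)] zA that by auto
      ultimately show ?thesis using zA y(1) F_simps(1) by (auto simp: colour_class_def)
    qed
  qed
  have class_B: "colour_class V F c = colour_class (B - {y}) p c \<union> (if c = b' then {z} else {})"
    if "c \<in> C - A" for c
  proof (rule set_eqI)
    fix v
    show "v \<in> colour_class V F c \<longleftrightarrow> v \<in> colour_class (B - {y}) p c \<union> (if c = b' then {z} else {})"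
    proof (cases "v \<in> B - {y}")
      case True
      then show ?thesis using F_simps(3) zB by (auto simp: colour_class_def)
    next
      case False
      moreover have "F v \<noteq> c" if "v \<in> V" "v \<noteq> z"
        using False FA[OF that(1)] \<open>c \<in> C - A\<close> that by auto
      ultimately show ?thesis using F_simps(2) z(1) by (auto simp: colour_class_def)
    qed
  qed
  \<comment> \<open>A conflict is symmetric and at most one end of an edge is \<open>y\<close>, so
    the case \<open>u = y\<close> may be excluded; likewise for \<open>z\<close> in the next
    fact.\<close>
  have ne: "F u \<noteq> F v" if uv: "u \<in> V" "v \<in> V" "E u v" "F u \<in> A" "u \<noteq> y" for u v
  proof
    assume eq: "F u = F v"
    then have "u \<notin> B - {y}" "u \<noteq> z" "v \<notin> B - {y}" "v \<noteq> z"
      using FA[OF uv(1)] FA[OF uv(2)] uv(4) by simp_all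
    then have u: "f u \<in> A" "F u = f u" using that F_simps(4) by auto
    show False
    proof (cases "v = y")
      case True
      then show False using u eq F_simps(1) uv sym z(3)[of u] \<open>u \<noteq> z\<close> by metis
    next
      case False
      then have "F v = f v" using \<open>v \<notin> B - {y}\<close> \<open>v \<noteq> z\<close> F_simps(4) uv by auto
      then show False using eq u uv f_proper unfolding proper_def by auto
    qed
  qed
  have ne': "F u \<noteq> F v" if uv: "u \<in> V" "v \<in> V" "E u v" "F u \<notin> A" "u \<noteq> z" for u v
  proof
    assume eq: "F u = F v"
    then have u: "u \<in> B - {y}" "v \<in> B - {y} \<or> v = z"
      using FA[OF uv(1)] FA[OF uv(2)] uv(4,5) by auto
    show False
    proof (cases "v = z")
      case True
      then have "u \<in> neighbours (B - {y}) z" using u uv sym by (auto simp: neighbours_def)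
      then show False using b'(2) eq True F_simps(2) F_simps(3)[OF u(1)] by force
    next
      case False
      then have v: "v \<in> B - {y}" using u by blast
      have "proper (B - {y}) p" using p unfolding equitable_def by blast
      then have "p u \<noteq> p v" using u(1) v uv(3) unfolding proper_def by blast
      then show False using eq F_simps(3)[OF u(1)] F_simps(3)[OF v] by simp
    qed
  qed
  have F_proper: "proper V F"
    unfolding proper_def
  proof (intro ballI impI)
    fix u v assume uv: "u \<in> V" "v \<in> V" "E u v"
    then have vu: "E v u" "u \<noteq> v" using sym irrefl by auto
    show "F u \<noteq> F v"
    proof (cases "F u \<in> A")
      case True
      show ?thesis
      proof
        assume "F u = F v"
        then show False using ne[OF uv True] ne[OF uv(2,1) vu(1)] True vu(2) by (cases "u = y") auto
      qed
    next
      case False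
      show ?thesis
      proof
        assume "F u = F v"
        then show False using ne'[OF uv False] ne'[OF uv(2,1) vu(1)] False vu(2) by (cases "u = z") auto
      qed
    qed
  qed
  have F_sizes: "card (colour_class V F c) + of_bool (c = a) = k + of_bool (c = b')" if c: "c \<in> C" for c
  proof -
    consider "c \<in> A - {f z}" | "c = f z" | "c \<in> C - A" using c by blast
    then show ?thesis
    proof cases
      case 1
      then show ?thesis using class_other sizes[OF c] bA b' by auto
    next
      case 2
      have "z \<in> colour_class V f (f z)" "y \<notin> colour_class V f (f z)" "finite (colour_class V f (f z))"
        using z zA y(1) finV by (auto simp: colour_class_def)
      then have "card (colour_class V F c) = card (colour_class V f c)"
        using 2 class_W card_Suc_Diff1[of "colour_class V f (f z)" z] by simp
      then show ?thesis using sizes[OF c] 2 zA bA b' by auto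
    next
      case 3
      have "card (colour_class (B - {y}) p c) = k" using p 3 unfolding equitable_def by auto
      moreover have "z \<notin> colour_class (B - {y}) p c" "finite (colour_class (B - {y}) p c)"
        using zB finV by (auto simp: colour_class_def)
      moreover have "c \<noteq> a" using 3 a_in_A by auto
      ultimately show ?thesis using class_B[OF 3] by (cases "c = b'") auto
    qed
  qed
  have "nearly_equitable E V C k F a b'"
  proof (intro nearly_equitable.intro nearly_equitable_axioms.intro)
    show "F ` V \<subseteq> C"
    proof
      fix c assume "c \<in> F ` V"
      then obtain v where v: "v \<in> V" "c = F v" by blast
      show "c \<in> C"
      proof (cases "F v \<in> A")
        case True
        then show ?thesis using v A_subset by auto
      next
        case False
        then have "v \<in> B - {y} \<or> v = z" using FA v by blast
        then show ?thesis using F_simps(2,3) pB b' v by auto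
      qed
    qed
    show "a \<noteq> b'" using a_in_A b' by auto
  qed (use finV finC ab b' F_proper F_sizes deg smaller loopless_graph_axioms in auto)
  \<comment> \<open>These paths avoid \<open>f z\<close>, the only class of \<open>A\<close> that
    has changed.\<close>
  moreover have old: "A - {f z} \<subseteq> accessible V F C a"
  proof
    fix c assume "c \<in> A - {f z}"
    then have "simple_path V f a ((C - {f z}) \<inter> A) c"
      using terminal by (intro simple_path_accessible) auto
    then have "simple_path V F a ((C - {f z}) \<inter> A) c"
      by (rule simple_path_cong) (use class_other in auto)
    then have "simple_path V F a C c" by (rule simple_path_mono) auto
    then show "c \<in> accessible V F C a" by (simp add: accessible_def)
  qed
  \<comment> \<open>The vertex behind the first arc out of \<open>f z\<close> is not
    \<open>z\<close>, which is stuck, so it survives the swap.\<close>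
  moreover have W: "f z \<in> accessible V F C a"
  proof -
    have "simple_path V f a C (f z)" using zA by (simp add: accessible_def)
    then obtain d where d: "arc V f (f z) d" "simple_path V f a (C - {f z}) d"
      using zA(2) by (auto elim: simple_path.cases)
    have "simple_path V f a C d" using d(2) by (rule simple_path_mono) auto
    then have dA: "d \<in> A - {f z}" using simple_path_mem(1)[OF d(2)] by (simp add: accessible_def)
    obtain x where x: "x \<in> V" "f x = f z" "movable V f x d" using d(1) by (auto simp: arc_def)
    have "x \<noteq> z" using x(3) stuck[OF dA] by auto
    then have "F x = f z" using F_simps(4) x zA by auto
    moreover have "movable V F x d" using x(3) class_other[OF dA] by (simp add: movable_iff)
    ultimately have "arc V F (f z) d" using x(1) by (auto simp: arc_def)
    moreover have "simple_path V F a C d" using old dA by (auto simp: accessible_def)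
    ultimately show ?thesis
      using zA A_subset simple_path_arc[of V F a C d "f z"] by (auto simp: accessible_def)
  qed
  \<comment> \<open>The single obstacle \<open>z\<close> has left its class, and its replacement
    \<open>y\<close> is not adjacent to \<open>y'\<close>.\<close>
  moreover have "F y' \<in> accessible V F C a" "F y' \<notin> A"
  proof -
    have y'B: "y' \<in> B - {y}" using y by auto
    have c: "F y' \<in> C - A" using F_simps(3)[OF y'B] pB[OF y'B] by simp
    have "\<not> E y' u" if "u \<in> colour_class V F (f z)" for u
    proof -
      have "u = y \<or> u \<in> colour_class V f (f z) - {z}" using that class_W by blast
      then show ?thesis using y(4) sym z'(3)[of u] by (auto simp: colour_class_def)
    qed
    then have "arc V F (F y') (f z)" using y'B by (auto simp: arc_def movable_iff)
    then show "F y' \<in> accessible V F C a" "F y' \<notin> A"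
      using W c simple_path_arc[of V F a C "f z" "F y'"] by (auto simp: accessible_def)
  qed
  ultimately show ?thesis by blast
qed

end

section \<open>Cut-off sets and the existence of a swap\<close>

context nearly_equitable
begin

text \<open>\<open>u\<close> separates the colours in \<open>cut_off u\<close> from \<open>a\<close>. For a minimal nonempty \<open>cut_off u\<close>, removing any one of
  its members disconnects no other colour from \<open>a\<close>.\<close>

definition cut_off :: "'c \<Rightarrow> 'c set" where
  "cut_off u = {c\<in>A. c \<noteq> u \<and> \<not> simple_path V f a (C - {u}) c}"

lemma a_not_cut_off: "a \<notin> cut_off u"
  using ab by (auto simp: cut_off_def intro: simple_path.base)

text \<open>Transitivity of domination in the colour digraph: every path from \<open>c\<close> to
  \<open>a\<close> passes \<open>w\<close>, and from there on it passes \<open>u\<close>. Strictness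
  ensures that the members of a smallest nonempty \<open>cut_off u\<close> cut off nothing
  themselves.\<close>

lemma cut_off_mono:
  assumes "u \<in> A" "w \<in> cut_off u"
  shows "cut_off w \<subset> cut_off u"
proof -
  have w: "w \<noteq> u" "\<not> simple_path V f a (C - {u}) w" "w \<in> A" using assms by (auto simp: cut_off_def)
  have "c \<in> cut_off u" if c: "c \<in> cut_off w" for c
  proof -
    have cw: "c \<noteq> w" "\<not> simple_path V f a (C - {w}) c" "c \<in> A" using c by (auto simp: cut_off_def)
    have "c \<noteq> u"
    proof
      assume "c = u"
      then show False using simple_path_avoids[of V f a C u w] w cw by (auto simp: accessible_def)
    qed
    moreover have "\<not> simple_path V f a (C - {u}) c"
    proof
      assume "simple_path V f a (C - {u}) c"
      from simple_path_avoids[OF this cw(1)[symmetric]] show False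
      proof
        assume "simple_path V f a (C - {u} - {w}) c"
        then have "simple_path V f a (C - {w}) c" by (rule simple_path_mono) auto
        then show False using cw by simp
      next
        assume "simple_path V f a (C - {u} - {c}) w"
        then have "simple_path V f a (C - {u}) w" by (rule simple_path_mono) auto
        then show False using w by simp
      qed
    qed
    ultimately show ?thesis using cw by (auto simp: cut_off_def)
  qed
  moreover have "w \<notin> cut_off w" by (auto simp: cut_off_def)
  ultimately show ?thesis using assms(2) by blast
qed

text \<open>Otherwise every vertex of \<open>B\<close> has a neighbour in the class of
  \<open>a\<close>. That class has fewer than \<open>k\<close> vertices, each of degree at most
  \<open>card (C - A)\<close>, too few to reach all of \<open>B\<close>.\<close>

lemma A_not_singleton:
  assumes "b \<notin> A"
  shows "A \<noteq> {a}"
proof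
  assume A: "A = {a}"
  let ?X = "colour_class V f a"
  have fin: "finite ?X" "finite B" using finV by (auto simp: colour_class_def)
  have "card B = (\<Sum>y\<in>B. 1)" by simp
  also have "\<dots> \<le> (\<Sum>y\<in>B. \<Sum>x | x \<in> ?X \<and> E y x. 1)"
  proof (intro sum_mono)
    fix y assume y: "y \<in> B"
    have "{x. x \<in> ?X \<and> E y x} = {u\<in>V. E y u \<and> f u = a}" by (auto simp: colour_class_def)
    then show "1 \<le> (\<Sum>x | x \<in> ?X \<and> E y x. (1::nat))"
      using not_movable_degree[OF B_not_movable[OF y a_in_A]] by simp
  qed
  also have "\<dots> = (\<Sum>x\<in>?X. 1 * card {y\<in>B. E x y})" by (rule sum_card_edges[OF fin, symmetric])
  also have "\<dots> \<le> (\<Sum>x\<in>?X. card (C - A))"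
  proof (intro sum_mono)
    fix x assume x: "x \<in> ?X"
    have "card {y\<in>B. E x y} \<le> card (neighbours V x)"
      using finV by (intro card_mono) (auto simp: neighbours_def)
    also have "\<dots> \<le> card (C - A)" using deg[of x] x card_colours A by (simp add: colour_class_def)
    finally show "1 * card {y\<in>B. E x y} \<le> card (C - A)" by simp
  qed
  also have "\<dots> \<le> k * card (C - A)" using sizes[OF ab(1)] ab by simp
  finally show False using card_B[OF assms] by simp
qed

lemma minimal_cut_off:
  assumes "b \<notin> A"
  obtains u where "u \<in> A" "cut_off u \<noteq> {}" "\<And>w. w \<in> cut_off u \<Longrightarrow> cut_off w = {}"
proof -
  obtain c where c: "c \<in> A" "c \<noteq> a" using A_not_singleton[OF assms] a_in_A by blast
  then have "c \<in> cut_off a" using simple_path_mem(2)[of V f a "C - {a}" c] by (auto simp: cut_off_def)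
  then have "a \<in> A \<and> cut_off a \<noteq> {}" using a_in_A by blast
  from ex_has_least_nat[of "\<lambda>u. u \<in> A \<and> cut_off u \<noteq> {}", OF this, of "\<lambda>u. card (cut_off u)"]
  obtain u where u: "u \<in> A" "cut_off u \<noteq> {}"
    "\<And>w. w \<in> A \<Longrightarrow> cut_off w \<noteq> {} \<Longrightarrow> card (cut_off u) \<le> card (cut_off w)" by blast
  have "cut_off w = {}" if "w \<in> cut_off u" for w
  proof (rule ccontr)
    assume "cut_off w \<noteq> {}"
    moreover have "w \<in> A" using that by (simp add: cut_off_def)
    moreover have "card (cut_off w) < card (cut_off u)"
      using finA by (intro psubset_card_mono cut_off_mono u that) (simp add: cut_off_def)
    ultimately show False using u(3) by force
  qed
  then show ?thesis using u that by blast
qed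

lemma solo_iff: "f z = w \<Longrightarrow> solo y z \<longleftrightarrow> {u\<in>V. E y u \<and> f u = w} = {z}"
  by (simp add: solo_def)

text \<open>Each vertex of \<open>B\<close> sends at least two units of weight into the class \<open>w\<close> when solo vertices
  weigh 2 and the others 1; comparing with the degrees into \<open>B\<close> gives the claim.\<close>

lemma many_cut_off:
  assumes bA: "b \<notin> A" and u: "u \<in> A" and w: "w \<in> cut_off u"
    and stuck: "\<And>z y c. f z = w \<Longrightarrow> y \<in> B \<Longrightarrow> solo y z \<Longrightarrow> c \<in> A - {w} \<Longrightarrow> \<not> movable V f z c"
  shows "card (C - A) < card (cut_off u)"
proof -
  let ?X = "colour_class V f w" and ?q = "card (C - A)" and ?t = "card (cut_off u)"
  define S where "S = {z\<in>?X. \<exists>y\<in>B. solo y z}"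
  define wt where "wt z = (if z \<in> S then 2 else 1 :: nat)" for z
  have wA: "w \<in> A" "w \<noteq> a" using w a_not_cut_off by (auto simp: cut_off_def)
  have fin: "finite ?X" "finite B" using finV by (auto simp: colour_class_def)
  have cut: "cut_off u \<subseteq> A" "u \<notin> cut_off u" by (auto simp: cut_off_def)
  have "2 * card B = (\<Sum>y\<in>B. 2)" by simp
  also have "\<dots> \<le> (\<Sum>y\<in>B. \<Sum>x | x \<in> ?X \<and> E y x. wt x)"
  proof (intro sum_mono)
    fix y assume y: "y \<in> B"
    let ?N = "{x. x \<in> ?X \<and> E y x}"
    have N: "?N = {u\<in>V. E y u \<and> f u = w}" by (auto simp: colour_class_def)
    have "1 \<le> card ?N" using not_movable_degree[OF B_not_movable[OF y wA(1)]] N by simp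
    then consider "card ?N = 1" | "2 \<le> card ?N" by linarith
    then show "2 \<le> (\<Sum>x | x \<in> ?X \<and> E y x. wt x)"
    proof cases
      case 1
      then obtain z where z: "?N = {z}" using card_1_singletonE by blast
      then have "z \<in> ?N" by blast
      then have "f z = w" "z \<in> ?X" by (auto simp: colour_class_def)
      moreover from this have "solo y z" using z N solo_iff by simp
      ultimately have "wt z = 2" using y by (auto simp: wt_def S_def)
      then show ?thesis unfolding z by simp
    next
      case 2
      also have "card ?N = (\<Sum>x | x \<in> ?X \<and> E y x. 1)" by simp
      also have "\<dots> \<le> (\<Sum>x | x \<in> ?X \<and> E y x. wt x)" by (intro sum_mono) (simp add: wt_def)
      finally show ?thesis .
    qed
  qed
  also have "\<dots> = (\<Sum>x\<in>?X. wt x * card {y\<in>B. E x y})" by (rule sum_card_edges[OF fin, symmetric])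
  \<comment> \<open>A solo vertex in class \<open>w\<close> is stuck and has at most
    \<open>?q\<close> neighbours in \<open>B\<close>, any other at most \<open>?t + ?q\<close>. If
    \<open>?t \<le> ?q\<close> held, the total would be at most \<open>2 * k * ?q\<close>, less than
    \<open>2 * card B\<close>.\<close>
  also have "\<dots> \<le> (\<Sum>x\<in>?X. if x \<in> S then 2 * ?q else ?t + ?q)"
  proof (intro sum_mono)
    fix x assume x: "x \<in> ?X"
    then have xV: "x \<in> V" "f x = w" by (auto simp: colour_class_def)
    have nB: "{y\<in>B. E x y} = neighbours B x" by (auto simp: neighbours_def)
    show "wt x * card {y\<in>B. E x y} \<le> (if x \<in> S then 2 * ?q else ?t + ?q)"
    proof (cases "x \<in> S")
      case True
      then have "\<not> movable V f x c" if "c \<in> A - {w}" for c using stuck that xV unfolding S_def by blast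
      then have "card (A - {w}) \<le> (\<Sum>c\<in>A. degree_in x c)" by (intro degree_in_A_ge) auto
      moreover have "card (A - {w}) + 1 = card A" using wA finA by (metis Suc_eq_plus1 card_Suc_Diff1)
      ultimately have "card (neighbours B x) \<le> ?q" using degree_split[OF xV(1)] by linarith
      then show ?thesis using True nB by (simp add: wt_def)
    next
      case False
      \<comment> \<open>A move from \<open>w\<close> to a colour that reaches \<open>a\<close>
        without \<open>u\<close> would let \<open>w\<close> bypass \<open>u\<close> too.\<close>
      have "\<not> movable V f x c" if c: "c \<in> A - cut_off u - {u}" for c
      proof
        assume "movable V f x c"
        then have "arc V f w c" using xV by (auto simp: arc_def)
        moreover have "simple_path V f a (C - {u}) c" using c by (auto simp: cut_off_def)
        moreover have "w \<in> C - {u}" using w A_subset by (auto simp: cut_off_def)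
        ultimately have "simple_path V f a (C - {u}) w" using simple_path_arc[of V f a "C - {u}" c w] by simp
        then show False using w by (simp add: cut_off_def)
      qed
      then have "card (A - cut_off u - {u}) \<le> (\<Sum>c\<in>A. degree_in x c)" by (intro degree_in_A_ge) auto
      moreover have "card (A - cut_off u - {u}) + 1 + ?t = card A"
      proof -
        have "card (A - cut_off u - {u}) + 1 = card (A - cut_off u)"
          using card_Suc_Diff1[of "A - cut_off u" u] finA u cut by simp
        moreover have "card (A - cut_off u) + ?t = card A"
          using cut(1) finA card_Diff_subset[OF finite_subset[OF cut(1) finA] cut(1)] card_mono[OF finA cut(1)]
          by linarith
        ultimately show ?thesis by linarith
      qed
      ultimately have "card (neighbours B x) \<le> ?t + ?q" using degree_split[OF xV(1)] by linarith
      then show ?thesis using False nB by (simp add: wt_def)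
    qed
  qed
  also have "\<dots> = card S * (2 * ?q) + card (?X - S) * (?t + ?q)"
  proof -
    have "?X \<inter> {x. x \<in> S} = S" "?X \<inter> - {x. x \<in> S} = ?X - S" by (auto simp: S_def)
    then show ?thesis using fin(1) by (simp add: sum.If_cases)
  qed
  finally have le: "2 * card B \<le> card S * (2 * ?q) + card (?X - S) * (?t + ?q)" .
  have "card ?X = k" using sizes[of w] wA A_subset bA by auto
  moreover have "card S + card (?X - S) = card ?X"
    using fin(1) card_Diff_subset[of S ?X] card_mono[of ?X S] by (auto simp: S_def)
  ultimately have "card B = (card S + card (?X - S)) * ?q + 1" using card_B[OF bA] by simp
  then have "2 * card B = card S * (2 * ?q) + card (?X - S) * (2 * ?q) + 2" by (simp add: algebra_simps)
  then have "card (?X - S) * (2 * ?q) < card (?X - S) * (?t + ?q)" using le by linarith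
  then show ?thesis by simp
qed

text \<open>Each class of \<open>A\<close> contains a neighbour of \<open>y\<close>, and each class
  of \<open>D\<close> without a solo neighbour contains two. Every missing solo neighbour thus costs
  one more unit of degree.\<close>

lemma solo_count:
  assumes "y \<in> B" "D \<subseteq> A"
  shows "card D + card (neighbours B y) < card (C - A) + card {z\<in>V. f z \<in> D \<and> solo y z}"
proof -
  let ?S = "{z\<in>V. f z \<in> D \<and> solo y z}"
  have finD: "finite D" using assms finA finite_subset by auto
  have inj: "inj_on f ?S"
  proof (rule inj_onI)
    fix z z' assume "z \<in> ?S" "z' \<in> ?S" "f z = f z'"
    then show "z = z'" using soloD[of y z] soloD[of y z'] by auto
  qed
  have fS: "f ` ?S \<subseteq> D" by auto
  have "card (A - D) + 2 * card (D - f ` ?S) + card (f ` ?S) \<le>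
      (\<Sum>c\<in>A - D. degree_in y c) + (\<Sum>c\<in>D - f ` ?S. degree_in y c) + (\<Sum>c\<in>f ` ?S. degree_in y c)"
  proof (intro add_mono)
    have one: "1 \<le> degree_in y c" if "c \<in> A" for c using not_movable_degree[OF B_not_movable[OF assms(1) that]] .
    show "card (A - D) \<le> (\<Sum>c\<in>A - D. degree_in y c)"
      using sum_mono[of "A - D" "\<lambda>_. 1" "degree_in y"] one by simp
    show "card (f ` ?S) \<le> (\<Sum>c\<in>f ` ?S. degree_in y c)"
      using sum_mono[of "f ` ?S" "\<lambda>_. 1" "degree_in y"] one assms(2) by auto
    have "2 \<le> degree_in y c" if c: "c \<in> D - f ` ?S" for c
    proof (rule ccontr)
      assume "\<not> ?thesis"
      then have "degree_in y c = 1" using one[of c] c assms(2) by force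
      then obtain z where z: "{u\<in>V. E y u \<and> f u = c} = {z}" using card_1_singletonE by blast
      then have "z \<in> {u\<in>V. E y u \<and> f u = c}" by blast
      then have "z \<in> V" "f z = c" by auto
      moreover from this have "solo y z" using z solo_iff by simp
      ultimately show False using c by blast
    qed
    then show "2 * card (D - f ` ?S) \<le> (\<Sum>c\<in>D - f ` ?S. degree_in y c)"
      using sum_mono[of "D - f ` ?S" "\<lambda>_. 2" "degree_in y"] by (simp add: mult.commute)
  qed
  also have "\<dots> = (\<Sum>c\<in>A. degree_in y c)"
    using sum.subset_diff[OF fS finD, of "degree_in y"] sum.subset_diff[OF assms(2) finA, of "degree_in y"] by simp
  finally have "card (A - D) + 2 * card (D - f ` ?S) + card (f ` ?S) \<le> (\<Sum>c\<in>A. degree_in y c)" .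
  moreover have "card (A - D) + card D = card A"
    using assms finA finD card_Diff_subset[of D A] card_mono[of A D] by auto
  moreover have "card (D - f ` ?S) + card (f ` ?S) = card D"
    using fS finD card_Diff_subset[OF finite_subset[OF fS finD] fS] card_mono[OF finD fS] by linarith
  moreover have "card (f ` ?S) = card ?S" using inj by (rule card_image)
  moreover have "(\<Sum>c\<in>A. degree_in y c) + card (neighbours B y) < card A + card (C - A)"
    using degree_split assms(1) by auto
  ultimately show ?thesis by linarith
qed

text \<open>Pigeonhole: an independent dominating set of \<open>B\<close> has at least
  \<open>k\<close> members, and summing \<open>solo_count\<close> over it gives more than
  \<open>k * card D\<close> solo pairs, whereas the classes in \<open>D\<close> have only
  \<open>k * card D\<close> vertices. Two members share \<open>z\<close>, and independence makes
  them nonadjacent.\<close>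

lemma nonadjacent_solo_neighbours:
  assumes bA: "b \<notin> A" and D: "D \<subseteq> A - {a}" and t: "card (C - A) < card D"
  obtains y y' z where "y \<in> B" "y' \<in> B" "y \<noteq> y'" "\<not> E y y'" "f z \<in> D" "solo y z" "solo y' z"
proof -
  let ?q = "card (C - A)" and ?t = "card D"
  define S where "S y = {z\<in>V. f z \<in> D \<and> solo y z}" for y
  have finB: "finite B" using finV by simp
  obtain I where I: "I \<subseteq> B" "\<And>u v. u \<in> I \<Longrightarrow> v \<in> I \<Longrightarrow> \<not> E u v"
    "card B \<le> (\<Sum>y\<in>I. card (neighbours B y) + 1)"
    using exists_dominating_independent_set[OF finB] by blast
  have finI: "finite I" using I(1) finB finite_subset by auto
  have "(\<Sum>y\<in>I. card (neighbours B y) + 1) \<le> (\<Sum>y\<in>I. ?q)"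
    using degree_B I(1) by (intro sum_mono) (auto simp: Suc_le_eq)
  moreover have "(\<Sum>y\<in>I. ?q) = card I * ?q" by simp
  ultimately have "k * ?q < card I * ?q" using I(3) card_B[OF bA] by linarith
  then have kI: "k \<le> card I" by (metis less_imp_le mult_less_cancel2)
  have "card {v\<in>V. f v \<in> D} = (\<Sum>c\<in>D. card (colour_class V f c))"
    using D A_subset by (intro card_colours_union) auto
  also have "\<dots> = (\<Sum>c\<in>D. k)"
  proof (intro sum.cong refl)
    fix c assume "c \<in> D"
    then have "c \<in> C" "c \<noteq> a" "c \<noteq> b" using D A_subset bA by auto
    then show "card (colour_class V f c) = k" using sizes[of c] by simp
  qed
  finally have cD: "card {v\<in>V. f v \<in> D} = ?t * k" by simp
  have "(\<Sum>y\<in>I. (?t - ?q) + (card (neighbours B y) + 1)) \<le> (\<Sum>y\<in>I. card (S y))"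
  proof (intro sum_mono)
    fix y assume "y \<in> I"
    then have "card D + card (neighbours B y) < ?q + card (S y)"
      unfolding S_def using I(1) D by (intro solo_count) auto
    then show "(?t - ?q) + (card (neighbours B y) + 1) \<le> card (S y)" using t by linarith
  qed
  moreover have "(\<Sum>y\<in>I. (?t - ?q) + (card (neighbours B y) + 1))
      = card I * (?t - ?q) + (\<Sum>y\<in>I. card (neighbours B y) + 1)"
    by (simp only: sum.distrib sum_constant of_nat_id)
  ultimately have "card I * (?t - ?q) + card B \<le> (\<Sum>y\<in>I. card (S y))" using I(3) by linarith
  moreover have "k * (?t - ?q) \<le> card I * (?t - ?q)" using kI by simp
  moreover have "k * (?t - ?q) + k * ?q = ?t * k" using t by (simp add: add_mult_distrib2[symmetric] mult.commute)
  ultimately have big: "card {v\<in>V. f v \<in> D} < (\<Sum>y\<in>I. card (S y))" using card_B[OF bA] cD by linarith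
  have "\<exists>y\<in>I. \<exists>y'\<in>I. y \<noteq> y' \<and> S y \<inter> S y' \<noteq> {}"
  proof (rule ccontr)
    assume "\<not> ?thesis"
    then have "card (\<Union>y\<in>I. S y) = (\<Sum>y\<in>I. card (S y))"
      using finI finV by (intro card_UN_disjoint) (auto simp: S_def)
    moreover have "card (\<Union>y\<in>I. S y) \<le> card {v\<in>V. f v \<in> D}"
      using finV by (intro card_mono) (auto simp: S_def)
    ultimately show False using big by linarith
  qed
  then obtain y y' z where "y \<in> I" "y' \<in> I" "y \<noteq> y'" "z \<in> S y" "z \<in> S y'" by blast
  then show ?thesis using that[of y y' z] I by (auto simp: S_def)
qed

text \<open>Either some solo vertex in the classes of a minimal \<open>cut_off u\<close> can move to
  another accessible class, which finishes directly, or all of them are stuck. Being stuck forces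
  \<open>cut_off u\<close> to be larger than \<open>C - A\<close>, and the pigeonhole then supplies
  the pair for the swap.\<close>

lemma improve:
  "(\<exists>g. equitable V C k g) \<or>
   (\<exists>g b'. nearly_equitable E V C k g a b' \<and> A \<subset> accessible V g C a)"
proof (cases "b \<in> A")
  case True
  then show ?thesis using equitable_if_accessible by blast
next
  case bA: False
  obtain u where u: "u \<in> A" "cut_off u \<noteq> {}" "\<And>w. w \<in> cut_off u \<Longrightarrow> cut_off w = {}"
    using minimal_cut_off[OF bA] by blast
  have terminal: "simple_path V f a (C - {w}) c" if "w \<in> cut_off u" "c \<in> A - {w}" for w c
    using u(3)[OF that(1)] that(2) by (auto simp: cut_off_def)
  have D: "cut_off u \<subseteq> A - {a}" using a_not_cut_off by (auto simp: cut_off_def)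
  show ?thesis
  proof (cases "\<exists>z y c. f z \<in> cut_off u \<and> y \<in> B \<and> solo y z \<and> c \<in> A - {f z} \<and> movable V f z c")
    case True
    then obtain z y c where z: "f z \<in> cut_off u" "y \<in> B" "solo y z" "c \<in> A - {f z}" "movable V f z c"
      by blast
    then have "\<exists>g. equitable V C k g"
      using D terminal by (intro equitable_if_solo_movable[OF bA _ _ z(5,2,3)]) auto
    then show ?thesis ..
  next
    case stuck: False
    obtain w where w: "w \<in> cut_off u" using u(2) by blast
    have "card (C - A) < card (cut_off u)" using stuck w by (intro many_cut_off[OF bA u(1) w]) blast
    then obtain y y' z where y: "y \<in> B" "y' \<in> B" "y \<noteq> y'" "\<not> E y y'" "f z \<in> cut_off u" "solo y z" "solo y' z"
      using nonadjacent_solo_neighbours[OF bA D] by blast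
    have "\<exists>g b'. nearly_equitable E V C k g a b' \<and> A \<subset> accessible V g C a"
    proof (rule swap_enlarges_accessible[OF bA, of z y y'])
      show "\<And>c. c \<in> A - {f z} \<Longrightarrow> \<not> movable V f z c" using stuck y by blast
    qed (use y D terminal in auto)
    then show ?thesis ..
  qed
qed

end

section \<open>Completing the induction for Hajnal--Szemeredi\<close>

context loopless_graph
begin

text \<open>The number of inaccessible colours decreases; the short colour \<open>a\<close> stays
  fixed while the surplus colour may change.\<close>

lemma equitable_of_nearly_equitable:
  assumes "nearly_equitable E V C k f a b"
  shows "\<exists>g. equitable V C k g"
  using assms
proof (induction "card C - card (accessible V f C a)" arbitrary: f b rule: less_induct)
  case less
  interpret nearly_equitable E V C k f a b by fact
  from improve show ?case
  proof
    assume "\<exists>g b'. nearly_equitable E V C k g a b' \<and> A \<subset> accessible V g C a"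
    then obtain g b' where g: "nearly_equitable E V C k g a b'" "A \<subset> accessible V g C a" by blast
    have sub: "accessible V g C a \<subseteq> C" using nearly_equitable.A_subset[OF g(1)] .
    then have "card A < card (accessible V g C a)" "card (accessible V g C a) \<le> card C"
      using g(2) finC by (auto intro: psubset_card_mono card_mono finite_subset)
    then show ?thesis using less.hyps[OF _ g(1)] by fastforce
  qed
qed

end

lemma exists_equal_classes:
  assumes "finite V" "finite C" "card V = k * card C"
  shows "\<exists>f. f ` V \<subseteq> C \<and> (\<forall>c\<in>C. card {v\<in>V. f v = c} = k)"
  using assms(2,1,3)
proof (induction C arbitrary: V rule: finite_induct)
  case empty
  then show ?case by auto
next
  case (insert c C)
  then have "k \<le> card V" by simp
  then obtain U where U: "U \<subseteq> V" "card U = k" "finite U" using obtain_subset_with_card_n by blast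
  then have "card (V - U) = k * card C" using insert by (simp add: card_Diff_subset)
  then obtain f where f: "f ` (V - U) \<subseteq> C" "\<And>d. d \<in> C \<Longrightarrow> card {v\<in>V - U. f v = d} = k"
    using insert.IH[of "V - U"] insert.prems by auto
  define g where "g v = (if v \<in> U then c else f v)" for v
  have "{v\<in>V. g v = c} = U" using f(1) U(1) insert.hyps unfolding g_def by auto
  moreover have "{v\<in>V. g v = d} = {v\<in>V - U. f v = d}" if "d \<in> C" for d
    using that insert.hyps U(1) unfolding g_def by auto
  moreover have "g ` V \<subseteq> insert c C" using f(1) unfolding g_def by auto
  ultimately show ?case using f(2) U(2) by (intro exI[of _ g]) auto
qed

theorem hajnal_szemeredi:
  fixes E :: "'v \<Rightarrow> 'v \<Rightarrow> bool" and C :: "'c set"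
  assumes "loopless_graph E" "finite V" "finite C" "card V = k * card C"
    and "\<And>v. v \<in> V \<Longrightarrow> card (loopless_graph.neighbours E V v) < card C"
  shows "\<exists>f. loopless_graph.equitable E V C k f"
  using assms
proof (induction "card C" arbitrary: E V C rule: less_induct)
  case less
  interpret G: loopless_graph E by fact
  \<comment> \<open>The vertices are activated one by one; each activation moves only one vertex.\<close>
  define EF where "EF F u v \<longleftrightarrow> E u v \<and> u \<in> F \<and> v \<in> F" for F u v
  have GF: "loopless_graph (EF F)" for F by standard (use G.sym G.irrefl in \<open>auto simp: EF_def\<close>)
  have deg: "card (loopless_graph.neighbours (EF F) V v) < card C" if "v \<in> V" for F v
  proof -
    have "card (loopless_graph.neighbours (EF F) V v) \<le> card (G.neighbours V v)"
      using less.prems(2) by (intro card_mono) (auto simp: G.neighbours_def loopless_graph.neighbours_def[OF GF] EF_def)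
    then show ?thesis using less.prems(5)[OF that] by linarith
  qed
  have "\<exists>f. loopless_graph.equitable (EF F) V C k f" if "finite F" for F
    using that
  proof (induction F rule: finite_induct)
    case empty
    interpret H: loopless_graph "EF {}" by (rule GF)
    show ?case using exists_equal_classes[OF less.prems(2-4)]
      unfolding H.equitable_def H.proper_def H.colour_class_def by (auto simp: EF_def)
  next
    case (insert u F)
    interpret H0: loopless_graph "EF F" by (rule GF)
    interpret H: loopless_graph "EF (insert u F)" by (rule GF)
    obtain f where f: "f ` V \<subseteq> C" "H0.proper V f" "\<And>c. c \<in> C \<Longrightarrow> card (H0.colour_class V f c) = k"
      using insert.IH unfolding H0.equitable_def by blast
    have cc: "H0.colour_class = H.colour_class" by (intro ext) (simp add: H0.colour_class_def H.colour_class_def)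
    show ?case
    \<comment> \<open>Before this step \<open>u\<close> has no active edge, so a new conflict can
      only be at \<open>u\<close>, with a neighbour of the same colour. Fewer than
      \<open>card C\<close> neighbours leave a free colour \<open>d\<close>; moving \<open>u\<close>
      there leaves its old class one short and class \<open>d\<close> one over.\<close>
    proof (cases "u \<in> V \<and> \<not> H.movable V f u (f u)")
      case False
      have "H.proper V f"
        unfolding H.proper_def
      proof (intro ballI impI)
        fix x y assume xy: "x \<in> V" "y \<in> V" "EF (insert u F) x y"
        then have "EF (insert u F) y x" using H.sym by blast
        then show "f x \<noteq> f y"
          using xy f(2) False unfolding H0.proper_def H.movable_def EF_def
          by (cases "x = u"; cases "y = u") auto
      qed
      then show ?thesis using f cc unfolding H.equitable_def by auto
    next
      case u: True
      have fin: "finite (H.neighbours V u)" using less.prems(2) by (simp add: H.neighbours_def)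
      have "card (f ` H.neighbours V u) < card C"
        using deg[of u] u card_image_le[OF fin, of f] by (metis le_less_trans)
      then have "\<not> C \<subseteq> f ` H.neighbours V u" using card_mono[of "f ` H.neighbours V u" C] fin by auto
      then obtain d where d: "d \<in> C" "d \<notin> f ` H.neighbours V u" by blast
      then have mov: "H.movable V f u d" by (auto simp: H.movable_def H.neighbours_def)
      then have fu: "f u \<noteq> d" using u by metis
      have f_upd: "H.proper V (f(u := d))"
        unfolding H.proper_def
      proof (intro ballI impI)
        fix x y assume xy: "x \<in> V" "y \<in> V" "EF (insert u F) x y"
        then have "x \<noteq> y" "EF (insert u F) y x" using H.irrefl H.sym by auto
        then show "(f(u := d)) x \<noteq> (f(u := d)) y"
          using xy f(2) mov unfolding H0.proper_def H.movable_def EF_def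
          by (cases "x = u"; cases "y = u") auto
      qed
      have "nearly_equitable (EF (insert u F)) V C k (f(u := d)) (f u) d"
      proof (intro nearly_equitable.intro nearly_equitable_axioms.intro GF)
        show "f u \<in> C" using u f(1) by auto
        show "(f(u := d)) ` V \<subseteq> C" using d f(1) by auto
        fix c assume "c \<in> C"
        then show "card (H.colour_class V (f(u := d)) c) + of_bool (c = f u) = k + of_bool (c = d)"
          using H.card_colour_class_update[of V u "f u" d f c] f(3)[of c] less.prems(2) u fu cc by simp
      next
        fix V' and C' :: "'c set"
        assume "C' \<subset> C" "V' \<subseteq> V" "card V' = k * card C'" "\<And>v. v \<in> V' \<Longrightarrow> card (H.neighbours V' v) < card C'"
        then show "\<exists>g. H.equitable V' C' k g"
          using less.prems(2,3) GF by (intro less.hyps) (auto intro: psubset_card_mono finite_subset)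
      qed (use less.prems d fu f_upd deg in auto)
      then show ?thesis by (rule H.equitable_of_nearly_equitable)
    qed
  qed
  from this[OF less.prems(2)] obtain f where f: "loopless_graph.equitable (EF V) V C k f" ..
  then have "G.equitable V C k f"
    by (auto simp: G.equitable_def loopless_graph.equitable_def[OF GF] G.proper_def loopless_graph.proper_def[OF GF]
        G.colour_class_def loopless_graph.colour_class_def[OF GF] EF_def)
  then show ?case by (rule exI[where x = f])
qed

section \<open>Families of sets without a large matching\<close>

lemma permutes_extending:
  assumes "finite V" "e \<subseteq> V" "e' \<subseteq> V" "card e = card e'"
  obtains \<sigma> where "\<sigma> permutes V" "\<sigma> ` e = e'"
proof -
  have fin: "finite e" "finite e'" using assms finite_subset by auto
  obtain f where f: "bij_betw f e e'" using finite_same_card_bij[OF fin assms(4)] by blast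
  have "card (V - e) = card (V - e')" using assms fin by (simp add: card_Diff_subset)
  then obtain g where g: "bij_betw g (V - e) (V - e')"
    using finite_same_card_bij[of "V - e" "V - e'"] assms(1) by blast
  define \<sigma> where "\<sigma> v = (if v \<in> e then f v else if v \<in> V then g v else v)" for v
  have s1: "bij_betw \<sigma> e e'" using f by (rule bij_betw_cong[THEN iffD1, rotated]) (simp add: \<sigma>_def)
  have s2: "bij_betw \<sigma> (V - e) (V - e')"
    using g by (rule bij_betw_cong[THEN iffD1, rotated]) (simp add: \<sigma>_def)
  have "bij_betw \<sigma> (e \<union> (V - e)) (e' \<union> (V - e'))" using s1 s2 by (rule bij_betw_combine) auto
  moreover have "e \<union> (V - e) = V" "e' \<union> (V - e') = V" using assms by auto
  ultimately have "bij_betw \<sigma> V V" by simp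
  then have "\<sigma> permutes V" by (rule bij_imp_permutes) (use assms in \<open>auto simp: \<sigma>_def\<close>)
  moreover have "\<sigma> ` e = e'" using s1 by (rule bij_betw_imp_surj_on)
  ultimately show ?thesis by (rule that)
qed

text \<open>Composing with a permutation that takes \<open>d\<close> to \<open>d'\<close> embeds the
  permutations sending \<open>e\<close> to \<open>d\<close> into those sending \<open>e\<close> to
  \<open>d'\<close>. Hence all \<open>r\<close>-sets are equally likely images of
  \<open>e\<close>.\<close>

lemma card_permutes_onto:
  assumes "finite V" "e \<in> nsets V r" "e' \<in> nsets V r"
  shows "(card V choose r) * card {p. p permutes V \<and> p ` e = e'} = card {p. p permutes V}"
proof -
  let ?c = "\<lambda>d. card {p. p permutes V \<and> p ` e = d}"
  have fin: "finite {p. p permutes V}" using assms(1) by (rule finite_permutations)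
  have le: "?c d \<le> ?c d'" if d: "d \<in> nsets V r" "d' \<in> nsets V r" for d d'
  proof -
    obtain s where s: "s permutes V" "s ` d = d'"
      using permutes_extending[of V d d'] assms(1) d by (auto simp: nsets_def)
    have "inj_on (\<lambda>p. s \<circ> p) {p. p permutes V \<and> p ` e = d}"
      using permutes_inj[OF s(1)] by (auto simp: inj_on_def fun_eq_iff dest: injD)
    moreover have "(\<lambda>p. s \<circ> p) ` {p. p permutes V \<and> p ` e = d} \<subseteq> {p. p permutes V \<and> p ` e = d'}"
      using s by (auto simp: permutes_compose image_comp[symmetric])
    ultimately show ?thesis using fin by (intro card_inj_on_le) auto
  qed
  have finN: "finite (nsets V r)" using assms(1) by (rule finite_imp_finite_nsets)
  have "card {p. p permutes V} = card (\<Union>d\<in>nsets V r. {p. p permutes V \<and> p ` e = d})"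
  proof (rule arg_cong[where f = card], rule set_eqI)
    fix p
    have "p ` e \<in> nsets V r" if p: "p permutes V"
    proof -
      have "card (p ` e) = card e" using permutes_inj[OF p] by (intro card_image) (auto intro: inj_on_subset)
      then show ?thesis using assms(2) permutes_image[OF p] by (auto simp: nsets_def)
    qed
    then show "p \<in> {p. p permutes V} \<longleftrightarrow> p \<in> (\<Union>d\<in>nsets V r. {p. p permutes V \<and> p ` e = d})" by auto
  qed
  also have "\<dots> = (\<Sum>d\<in>nsets V r. ?c d)" using fin finN by (intro card_UN_disjoint) auto
  also have "\<dots> = (\<Sum>d\<in>nsets V r. ?c e')" using le assms(3) by (intro sum.cong refl antisym) auto
  finally show ?thesis by simp
qed

lemma exists_disjoint_nsets:
  assumes "finite V" "0 < r" "r * N \<le> card V"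
  obtains M where "M \<subseteq> nsets V r" "disjoint M" "card M = N"
proof -
  obtain U where U: "U \<subseteq> V" "card U = r * N" "finite U"
    using obtain_subset_with_card_n[OF assms(3)] by blast
  then obtain f where f: "f ` U \<subseteq> {..<N}" "\<And>c. c < N \<Longrightarrow> card {v\<in>U. f v = c} = r"
    using exists_equal_classes[of U "{..<N}" r] by auto
  define M where "M = (\<lambda>c. {v\<in>U. f v = c}) ` {..<N}"
  have ne: "{v\<in>U. f v = c} \<noteq> {}" if "c < N" for c using f(2)[OF that] assms(2) by (metis card.empty less_irrefl)
  have "inj_on (\<lambda>c. {v\<in>U. f v = c}) {..<N}"
  proof (rule inj_onI)
    fix c d assume "c \<in> {..<N}" "{v\<in>U. f v = c} = {v\<in>U. f v = d}"
    then show "c = d" using ne[of c] by blast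
  qed
  then have "card M = N" unfolding M_def by (simp add: card_image)
  moreover have "disjoint M" unfolding M_def by (rule disjointI) auto
  moreover have "M \<subseteq> nsets V r" using U f(2) unfolding M_def nsets_def by auto
  ultimately show ?thesis by (intro that)
qed

text \<open>A random permutation moves a fixed family of \<open>n div r\<close> disjoint \<open>r\<close>-sets to a family that
  contains at most \<open>k - 1\<close> members of \<open>R\<close>.\<close>

lemma card_no_matching:
  assumes "finite V" "0 < r" "R \<subseteq> nsets V r"
    and nomatch: "\<And>M. M \<subseteq> R \<Longrightarrow> disjoint M \<Longrightarrow> card M < k"
  shows "(card V div r) * card R \<le> (k - 1) * (card V choose r)"
proof -
  let ?P = "{p. p permutes V}" and ?C = "card V choose r"
  obtain M where M: "M \<subseteq> nsets V r" "disjoint M" "card M = card V div r"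
    using exists_disjoint_nsets[of V r "card V div r"] assms by auto
  have finN: "finite (nsets V r)" using assms(1) by (rule finite_imp_finite_nsets)
  have fin: "finite ?P" "finite M" "finite R"
    using assms(1,3) finite_permutations finN M(1) finite_subset by auto
  have count: "?C * card {p. p permutes V \<and> p ` e \<in> R} = card R * card ?P" if e: "e \<in> M" for e
  proof -
    have "{p. p permutes V \<and> p ` e \<in> R} = (\<Union>d\<in>R. {p. p permutes V \<and> p ` e = d})" by auto
    also have "card \<dots> = (\<Sum>d\<in>R. card {p. p permutes V \<and> p ` e = d})"
      using fin by (intro card_UN_disjoint) auto
    finally have "?C * card {p. p permutes V \<and> p ` e \<in> R} = (\<Sum>d\<in>R. ?C * card {p. p permutes V \<and> p ` e = d})"
      by (simp add: sum_distrib_left)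
    also have "\<dots> = (\<Sum>d\<in>R. card ?P)"
      using card_permutes_onto[OF assms(1)] e M(1) assms(3) by (intro sum.cong refl) blast
    finally show ?thesis by simp
  qed
  have few: "card {e\<in>M. p ` e \<in> R} \<le> k - 1" if p: "p permutes V" for p
  proof -
    let ?N = "{e\<in>M. p ` e \<in> R}"
    have inj: "inj_on p (\<Union>?N)" using permutes_inj[OF p] by (auto intro: inj_on_subset)
    have "disjoint ?N" using M(2) by (auto simp: pairwise_def)
    then have "disjoint ((`) p ` ?N)" using inj by (intro disjoint_image)
    then have "card ((`) p ` ?N) < k" by (intro nomatch) auto
    moreover have "card ((`) p ` ?N) = card ?N" using inj by (intro card_image inj_on_image)
    ultimately show ?thesis by linarith
  qed
  \<comment> \<open>Pairs of a member of \<open>M\<close> and a permutation taking it into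
    \<open>R\<close> are counted in two ways; the factor \<open>?C\<close> avoids fractions.\<close>
  have "(card V div r) * card R * card ?P = (\<Sum>e\<in>M. ?C * card {p. p permutes V \<and> p ` e \<in> R})"
    using count M(3) by simp
  also have "\<dots> = ?C * (\<Sum>e\<in>M. \<Sum>p\<in>?P. of_bool (p ` e \<in> R))"
    using fin by (simp add: sum_distrib_left[symmetric] Int_def)
  also have "\<dots> = ?C * (\<Sum>p\<in>?P. \<Sum>e\<in>M. of_bool (p ` e \<in> R))" by (subst sum.swap) (rule refl)
  also have "\<dots> = ?C * (\<Sum>p\<in>?P. card {e\<in>M. p ` e \<in> R})" using fin by (simp add: Int_def)
  also have "\<dots> \<le> ?C * (\<Sum>p\<in>?P. k - 1)" using few by (intro mult_left_mono sum_mono) auto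
  also have "\<dots> = (k - 1) * ?C * card ?P" by simp
  finally have "(card V div r) * card R * card ?P \<le> (k - 1) * ?C * card ?P" .
  moreover have "0 < card ?P" using fin(1) permutes_id[of V] card_gt_0_iff by blast
  ultimately show ?thesis by simp
qed

section \<open>Packings of matchings and decompositions\<close>

text \<open>\<open>disjoint\<close> acts on two levels: different members share no edge, and the
  edges within one member share no vertex.\<close>

definition matching_packing :: "nat \<Rightarrow> 'a set set \<Rightarrow> 'a set set set \<Rightarrow> bool" where
  "matching_packing k E \<Q> \<longleftrightarrow>
     disjoint \<Q> \<and> (\<forall>P\<in>\<Q>. P \<subseteq> E \<and> card P = k \<and> disjoint P)"

lemma matching_packing_card:
  assumes "matching_packing k E \<Q>" "finite E"
  shows "card (\<Union>\<Q>) = k * card \<Q>" "\<Union>\<Q> \<subseteq> E" "finite \<Q>"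
proof -
  have P: "P \<subseteq> E" "card P = k" if "P \<in> \<Q>" for P using assms that by (auto simp: matching_packing_def)
  show "\<Union>\<Q> \<subseteq> E" using P by blast
  show "finite \<Q>" using P assms(2) by (intro finite_subset[of \<Q> "Pow E"]) auto
  have "card (\<Union>\<Q>) = (\<Sum>P\<in>\<Q>. card P)"
    using assms P(1) rev_finite_subset[OF assms(2)]
    by (intro card_Union_disjoint) (auto simp: matching_packing_def)
  then show "card (\<Union>\<Q>) = k * card \<Q>" using P by simp
qed

lemma perfect_matching_packing:
  assumes "finite E" "k \<ge> 1"
    and deg: "\<And>e. e \<in> E \<Longrightarrow> card {e'\<in>E. e \<noteq> e' \<and> e \<inter> e' \<noteq> {}} < card E div k"
  shows "\<exists>\<Q>. matching_packing k E \<Q> \<and> card \<Q> = card E div k"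
proof -
  define q where "q = card E div k"
  define L where "L e e' \<longleftrightarrow> e \<noteq> e' \<and> e \<inter> e' \<noteq> {}" for e e' :: "'a set"
  interpret L: loopless_graph L by standard (auto simp: L_def)
  have "k * q \<le> card E" unfolding q_def by simp
  then obtain U where U: "U \<subseteq> E" "card U = k * q" "finite U" using obtain_subset_with_card_n by blast
  have "\<exists>f. L.equitable U {..<q} k f"
  proof (rule hajnal_szemeredi)
    show "loopless_graph L" by (rule L.loopless_graph_axioms)
    fix e assume "e \<in> U"
    have "card (L.neighbours U e) \<le> card {e'\<in>E. e \<noteq> e' \<and> e \<inter> e' \<noteq> {}}"
      using U assms(1) by (intro card_mono) (auto simp: L.neighbours_def L_def)
    then show "card (L.neighbours U e) < card {..<q}" using deg[of e] \<open>e \<in> U\<close> U(1) by (auto simp: q_def)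
  qed (use U in auto)
  then obtain f where f: "f ` U \<subseteq> {..<q}" "L.proper U f" "\<And>c. c < q \<Longrightarrow> card (L.colour_class U f c) = k"
    unfolding L.equitable_def by auto
  have ne: "L.colour_class U f c \<noteq> {}" if "c < q" for c
    using f(3)[OF that] assms(2) by auto
  have inj: "inj_on (L.colour_class U f) {..<q}"
  proof (rule inj_onI)
    fix c d assume "c \<in> {..<q}" "L.colour_class U f c = L.colour_class U f d"
    then show "c = d" using ne[of c] by (auto simp: L.colour_class_def)
  qed
  have "matching_packing k E (L.colour_class U f ` {..<q})"
    unfolding matching_packing_def
  proof (intro conjI ballI)
    show "disjoint (L.colour_class U f ` {..<q})" by (rule disjointI) (auto simp: L.colour_class_def)
    fix P assume "P \<in> L.colour_class U f ` {..<q}"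
    then obtain c where c: "c < q" "P = L.colour_class U f c" by auto
    show "card P = k" using c f(3) by simp
    show "P \<subseteq> E" using c U(1) by (auto simp: L.colour_class_def)
    show "disjoint P"
    proof (rule disjointI)
      fix x y assume "x \<in> P" "y \<in> P" "x \<noteq> y"
      then show "x \<inter> y = {}" using f(2) c by (auto simp: L.proper_def L.colour_class_def L_def)
    qed
  qed
  moreover have "card (L.colour_class U f ` {..<q}) = q" using inj by (simp add: card_image)
  ultimately show ?thesis unfolding q_def by blast
qed

lemma exists_maximal_matching_packing:
  assumes "finite E" "k \<ge> 1"
  obtains \<Q> where "matching_packing k E \<Q>"
    "\<And>M. M \<subseteq> E - \<Union>\<Q> \<Longrightarrow> disjoint M \<Longrightarrow> card M < k"
proof -
  let ?F = "{\<Q>. matching_packing k E \<Q>}"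
  have "finite ?F"
    using assms(1) by (intro finite_subset[of ?F "Pow (Pow E)"]) (auto simp: matching_packing_def)
  moreover have "{} \<in> ?F" by (simp add: matching_packing_def)
  ultimately obtain \<Q> where Q: "\<Q> \<in> ?F" "\<And>\<R>. \<R> \<in> ?F \<Longrightarrow> \<Q> \<subseteq> \<R> \<Longrightarrow> \<R> = \<Q>"
    using finite_has_maximal2[of ?F "{}"] by (metis (no_types, lifting))
  have "card M < k" if M: "M \<subseteq> E - \<Union>\<Q>" "disjoint M" for M
  proof (rule ccontr)
    assume "\<not> card M < k"
    then obtain P where P: "P \<subseteq> M" "card P = k" using obtain_subset_with_card_n[of k M] by auto
    have "insert P \<Q> \<in> ?F"
      using Q(1) P M unfolding matching_packing_def
      by (auto simp: pairwise_insert disjnt_iff intro: pairwise_subset)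
    then have "P \<in> \<Q>" using Q(2) by blast
    moreover have "P \<noteq> {}" using P(2) assms(2) by auto
    ultimately show False using P(1) M(1) by blast
  qed
  then show ?thesis using Q(1) that by blast
qed

section \<open>Degrees in the line graph\<close>

lemma card_nsets_containing:
  assumes "finite V" "v \<in> V" "0 < r"
  shows "card {e\<in>nsets V r. v \<in> e} = (card V - 1) choose (r - 1)"
proof -
  have "bij_betw (insert v) (nsets (V - {v}) (r - 1)) {e\<in>nsets V r. v \<in> e}"
  proof (rule bij_betw_byWitness[where f' = "\<lambda>e. e - {v}"])
    show "insert v ` nsets (V - {v}) (r - 1) \<subseteq> {e\<in>nsets V r. v \<in> e}"
      using assms by (auto simp: nsets_def card_insert_if)
    show "(\<lambda>e. e - {v}) ` {e\<in>nsets V r. v \<in> e} \<subseteq> nsets (V - {v}) (r - 1)"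
      by (auto simp: nsets_def)
  qed (auto simp: nsets_def)
  then have "card {e\<in>nsets V r. v \<in> e} = card (nsets (V - {v}) (r - 1))" by (rule bij_betw_same_card[symmetric])
  moreover have "card (V - {v}) = card V - 1" using assms by simp
  ultimately show ?thesis by simp
qed

text \<open>Each of the \<open>r\<close> vertices of \<open>e\<close> lies in
  \<open>card V - 1 choose (r - 1)\<close> of the \<open>r\<close>-sets, and one of them is
  \<open>e\<close> itself. Not counting it is what later yields
  \<open>?m < k * (r * D)\<close>.\<close>

lemma card_intersecting_edges:
  assumes "finite V" "0 < r" "E \<subseteq> nsets V r" "e \<in> E"
  shows "card {e'\<in>E. e \<noteq> e' \<and> e \<inter> e' \<noteq> {}} \<le> r * ((card V - 1 choose (r - 1)) - 1)"
proof -
  have e: "e \<subseteq> V" "finite e" "card e = r" using assms by (auto simp: nsets_def)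
  have finN: "finite (nsets V r)" using assms(1) by (rule finite_imp_finite_nsets)
  have "{e'\<in>E. e \<noteq> e' \<and> e \<inter> e' \<noteq> {}} \<subseteq> (\<Union>v\<in>e. {e'\<in>nsets V r. v \<in> e'} - {e})"
    using assms(3) by auto
  then have "card {e'\<in>E. e \<noteq> e' \<and> e \<inter> e' \<noteq> {}} \<le> card (\<Union>v\<in>e. {e'\<in>nsets V r. v \<in> e'} - {e})"
    using e finN by (intro card_mono) auto
  also have "\<dots> \<le> (\<Sum>v\<in>e. card ({e'\<in>nsets V r. v \<in> e'} - {e}))" using e by (intro card_UN_le)
  also have "\<dots> = (\<Sum>v\<in>e. (card V - 1 choose (r - 1)) - 1)"
  proof (intro sum.cong refl)
    fix v assume v: "v \<in> e"
    have "e \<in> {e'\<in>nsets V r. v \<in> e'}" using v assms by auto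
    then show "card ({e'\<in>nsets V r. v \<in> e'} - {e}) = (card V - 1 choose (r - 1)) - 1"
      using card_nsets_containing[OF assms(1) _ assms(2), of v] v e(1) by (auto simp: card_Diff_singleton)
  qed
  finally show ?thesis using e(3) by simp
qed

text \<open>Bijections between corresponding edges glue to one vertex bijection, since on both sides
  each vertex lies in exactly one edge.\<close>

lemma matching_iso_independent_edges:
  assumes H: "independent_edges r k H" and P: "card P = k" "disjoint P" "\<And>e. e \<in> P \<Longrightarrow> finite e \<and> card e = r"
    and k: "k \<ge> 1"
  shows "hypergraph_iso (edge_hypergraph P) H"
proof -
  have HE: "edges H \<subseteq> nsets (verts H) r" "verts H = \<Union>(edges H)" "card (edges H) = k" "disjoint (edges H)"
    using H by (auto simp: independent_edges_def r_graph_def)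
  have "finite P" "finite (edges H)" using P(1) HE(3) k by (auto intro: card_ge_0_finite)
  then obtain g where g: "bij_betw g P (edges H)" using finite_same_card_bij[of P "edges H"] P(1) HE(3) by auto
  have "\<exists>h. bij_betw h e (g e)" if "e \<in> P" for e
  proof -
    have "g e \<in> edges H" using g that bij_betwE by blast
    then have "finite (g e)" "card (g e) = r" using HE(1) by (auto simp: nsets_def)
    then show ?thesis using finite_same_card_bij[of e "g e"] P(3)[OF that] by auto
  qed
  then obtain h where h: "\<And>e. e \<in> P \<Longrightarrow> bij_betw (h e) e (g e)" by metis
  define f where "f v = h (THE e. e \<in> P \<and> v \<in> e) v" for v
  have f: "f v = h e v" if "e \<in> P" "v \<in> e" for e v
  proof -
    have "(THE e. e \<in> P \<and> v \<in> e) = e" using that disjointD[OF P(2)] by (intro the_equality) auto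
    then show ?thesis by (simp add: f_def)
  qed
  have fe: "bij_betw f e (g e)" if "e \<in> P" for e
    using h[OF that] f[OF that] by (metis bij_betw_cong)
  have "bij_betw f (\<Union>e\<in>P. e) (\<Union>e\<in>P. g e)"
  proof (rule bij_betw_UNION_disjoint)
    show "disjoint_family_on g P"
      unfolding disjoint_family_on_def
    proof (intro ballI impI)
      fix e e' assume "e \<in> P" "e' \<in> P" "e \<noteq> e'"
      then have "g e \<in> edges H" "g e' \<in> edges H" "g e \<noteq> g e'"
        using g by (auto simp: bij_betw_def inj_on_def)
      then show "g e \<inter> g e' = {}" using disjointD[OF HE(4)] by blast
    qed
  qed (rule fe)
  moreover have "(\<Union>e\<in>P. g e) = verts H" using g HE(2) by (simp add: bij_betw_def)
  moreover have "edges H = (\<lambda>e. f ` e) ` P"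
  proof -
    have "(\<lambda>e. f ` e) ` P = g ` P" using fe by (intro image_cong refl) (simp add: bij_betw_def)
    then show ?thesis using g by (simp add: bij_betw_def)
  qed
  ultimately show ?thesis unfolding hypergraph_iso_def edge_hypergraph_def by (intro exI[of _ f]) simp
qed

lemma card_part_iso:
  assumes "independent_edges r k H" "hypergraph_iso (edge_hypergraph P) H"
  shows "card P = k"
proof -
  obtain f where f: "bij_betw f (\<Union>P) (verts H)" "edges H = (\<lambda>e. f ` e) ` P"
    using assms(2) by (auto simp: hypergraph_iso_def edge_hypergraph_def)
  have "inj_on ((`) f) P" using f(1) by (intro inj_on_image) (simp add: bij_betw_def)
  then have "card (edges H) = card P" using f(2) by (simp add: card_image)
  then show ?thesis using assms(1) by (simp add: independent_edges_def)
qed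

lemma finite_edges: "r_graph r G \<Longrightarrow> finite (edges G)"
  by (auto simp: r_graph_def intro: finite_subset finite_imp_finite_nsets)

lemma finite_decomposition_sizes:
  assumes "r_graph r G"
  shows "finite {card \<P> |\<P>. H_decomposition H G \<P>}"
proof -
  have "{card \<P> |\<P>. H_decomposition H G \<P>} \<subseteq> card ` {\<P>. partition_on (edges G) \<P>}"
    by (auto simp: H_decomposition_def)
  then show ?thesis using finitely_many_partition_on[OF finite_edges[OF assms]] finite_subset by blast
qed

lemma phi_graph_le:
  assumes G: "r_graph r G" and H: "independent_edges r k H" and k: "k \<ge> 1"
    and Q: "matching_packing k (edges G) \<Q>"
  shows "phi_graph H G \<le> card \<Q> + card (edges G - \<Union>\<Q>)"
proof -
  let ?R = "edges G - \<Union>\<Q>" and ?P = "\<Q> \<union> (\<lambda>e. {e}) ` (edges G - \<Union>\<Q>)"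
  have finE: "finite (edges G)" using G by (rule finite_edges)
  note pack = matching_packing_card[OF Q finE]
  have "partition_on (edges G) ?P"
  proof (rule partition_onI)
    show "\<Union>?P = edges G" using pack(2) by blast
    show "{} \<notin> ?P" using Q k by (auto simp: matching_packing_def)
    fix p q assume pq: "p \<in> ?P" "q \<in> ?P" "p \<noteq> q"
    have "disjoint \<Q>" using Q by (simp add: matching_packing_def)
    then show "disjnt p q"
      using pq by (cases "p \<in> \<Q>"; cases "q \<in> \<Q>") (auto simp: disjnt_def dest: disjointD)
  qed
  moreover have "(\<exists>e. P = {e}) \<or> hypergraph_iso (edge_hypergraph P) H" if "P \<in> ?P" for P
  proof (cases "P \<in> \<Q>")
    case True
    then have P: "P \<subseteq> edges G" "card P = k" "disjoint P" using Q by (auto simp: matching_packing_def)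
    have "finite e \<and> card e = r" if "e \<in> P" for e using P(1) that G by (auto simp: r_graph_def nsets_def)
    then have "hypergraph_iso (edge_hypergraph P) H"
      using P(2,3) by (intro matching_iso_independent_edges[OF H _ _ _ k])
    then show ?thesis ..
  qed (use that in auto)
  ultimately have "H_decomposition H G ?P" by (simp add: H_decomposition_def)
  then have "phi_graph H G \<le> card ?P"
    unfolding phi_graph_def using finite_decomposition_sizes[OF G] by (intro Min_le) auto
  also have "\<dots> \<le> card \<Q> + card ((\<lambda>e. {e}) ` ?R)" by (rule card_Un_le)
  also have "\<dots> \<le> card \<Q> + card ?R" using finE by (simp add: card_image_le)
  finally show ?thesis .
qed

text \<open>Using \<open>d\<close> copies of \<open>H\<close> fewer than \<open>?m div k\<close>
  leaves \<open>k * d\<close> further single edges, which is no saving because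
  \<open>d \<le> k * d\<close>.\<close>

lemma phi_graph_ge:
  assumes G: "r_graph r G" and H: "independent_edges r k H" and k: "k \<ge> 1"
  shows "card (edges G) div k + card (edges G) mod k \<le> phi_graph H G"
proof -
  let ?m = "card (edges G)" and ?S = "{card \<P> |\<P>. H_decomposition H G \<P>}"
  have finE: "finite (edges G)" using G by (rule finite_edges)
  have "H_decomposition H G ((\<lambda>e. {e}) ` edges G)"
    using partition_on_singletons by (auto simp: H_decomposition_def)
  then have "?S \<noteq> {}" by blast
  moreover have "?m div k + ?m mod k \<le> card \<P>" if "H_decomposition H G \<P>" for \<P>
  proof -
    have part: "partition_on (edges G) \<P>"
      and parts: "\<And>P. P \<in> \<P> \<Longrightarrow> (\<exists>e. P = {e}) \<or> hypergraph_iso (edge_hypergraph P) H"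
      using that by (auto simp: H_decomposition_def)
    have finP: "finite \<P>" using finE part by (rule finite_elements)
    have size: "card P = 1 \<or> card P = k" if "P \<in> \<P>" for P using parts[OF that] card_part_iso[OF H] by auto
    \<comment> \<open>Splitting by size \<open>k\<close> rather than by being a single edge keeps
      the two sets disjoint for \<open>k = 1\<close>.\<close>
    define \<S> where "\<S> = {P\<in>\<P>. card P \<noteq> k}"
    define \<H> where "\<H> = {P\<in>\<P>. card P = k}"
    have split: "\<P> = \<S> \<union> \<H>" "\<S> \<inter> \<H> = {}" "finite \<S>" "finite \<H>" using finP by (auto simp: \<S>_def \<H>_def)
    have "?m = (\<Sum>P\<in>\<P>. card P)"
      using part finE by (intro product_partition) (auto simp: partition_on_def intro: finite_subset)
    also have "\<dots> = (\<Sum>P\<in>\<S>. card P) + (\<Sum>P\<in>\<H>. card P)" using split by (simp add: sum.union_disjoint)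
    also have "(\<Sum>P\<in>\<S>. card P) = (\<Sum>P\<in>\<S>. 1)" using size by (intro sum.cong) (auto simp: \<S>_def)
    also have "(\<Sum>P\<in>\<H>. card P) = (\<Sum>P\<in>\<H>. k)" by (intro sum.cong) (auto simp: \<H>_def)
    finally have m: "?m = card \<S> + k * card \<H>" by simp
    have c: "card \<P> = card \<S> + card \<H>" using split by (simp add: card_Un_disjoint)
    have "card \<H> \<le> ?m div k" using m k by (simp add: less_eq_div_iff_mult_less_eq mult.commute)
    then obtain d where d: "?m div k = card \<H> + d" using le_Suc_ex by blast
    have "card \<S> + k * card \<H> = k * (card \<H> + d) + ?m mod k" using m d by (metis mult_div_mod_eq)
    then have "card \<S> = k * d + ?m mod k" by (simp add: algebra_simps)
    moreover have "d \<le> k * d" using k by simp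
    ultimately show ?thesis using c d by linarith
  qed
  ultimately show ?thesis
    unfolding phi_graph_def using finite_decomposition_sizes[OF G] by (subst Min_ge_iff) auto
qed

section \<open>Extremal graphs\<close>

lemma phi_graph_dichotomy:
  assumes k: "k \<ge> 1" and r: "r \<ge> 2" and H: "independent_edges r k H"
    and n: "n \<ge> k * r * (k + r - 2) + 2 * r - 1"
    and G: "r_graph r G" "card (verts G) = n"
  shows "phi_graph H G = card (edges G) div k + card (edges G) mod k \<or> k * phi_graph H G < n choose r"
proof -
  let ?E = "edges G" and ?m = "card (edges G)" and ?V = "verts G" and ?C = "n choose r"
  have finE: "finite ?E" using G(1) by (rule finite_edges)
  have GV: "finite ?V" "?E \<subseteq> nsets ?V r" using G(1) by (auto simp: r_graph_def)
  show ?thesis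
  proof (cases "\<forall>e\<in>?E. card {e'\<in>?E. e \<noteq> e' \<and> e \<inter> e' \<noteq> {}} < ?m div k")
    case True
    then obtain \<Q> where Q: "matching_packing k ?E \<Q>" "card \<Q> = ?m div k"
      using perfect_matching_packing[OF finE k] by blast
    note pack = matching_packing_card[OF Q(1) finE]
    have "card (?E - \<Union>\<Q>) = ?m - k * (?m div k)"
      using pack Q(2) finE card_Diff_subset[of "\<Union>\<Q>" ?E] finite_subset by auto
    also have "\<dots> = ?m mod k" by (simp add: minus_mult_div_eq_mod)
    finally have "phi_graph H G \<le> ?m div k + ?m mod k" using phi_graph_le[OF G(1) H k Q(1)] Q(2) by simp
    then show ?thesis using phi_graph_ge[OF G(1) H k] by simp
  next
    case False
    then obtain e where e: "e \<in> ?E" "?m div k \<le> card {e'\<in>?E. e \<noteq> e' \<and> e \<inter> e' \<noteq> {}}" by force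
    define D where "D = (n - 1 choose (r - 1))"
    define N where "N = n div r"
    have N_ge: "k * r + (k - 1) * (k - 1) \<le> N"
    proof -
      \<comment> \<open>Writing \<open>k\<close> and \<open>r\<close> as successors removes the
        truncated subtractions; the two sides below then differ by exactly
        \<open>r - 1\<close>.\<close>
      obtain j where j: "k = Suc j" using k by (cases k) auto
      obtain s where s: "r = Suc (Suc s)" using r by (metis add_2_eq_Suc le_Suc_ex)
      have "(k * r + (k - 1) * (k - 1)) * r \<le> k * r * (k + r - 2) + 2 * r - 1"
        unfolding j s by (simp add: algebra_simps)
      also have "\<dots> \<le> n" by (rule n)
      finally show ?thesis unfolding N_def using r by (simp add: less_eq_div_iff_mult_less_eq)
    qed
    have N0: "0 < N" using N_ge k r by (cases N) auto
    have rn: "r \<le> n" using N0 r unfolding N_def by (simp add: div_greater_zero_iff)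
    have D0: "0 < D" unfolding D_def using rn by simp
    have "r * (N * D) \<le> n * D" unfolding N_def using times_div_less_eq_dividend[of r n] by (simp add: mult.assoc[symmetric])
    also have "n * D = r * ?C"
      using Suc_times_binomial[of "r - 1" "n - 1"] r rn unfolding D_def by simp
    finally have ND: "N * D \<le> ?C" using r by simp
    have "?m div k \<le> r * (D - 1)"
      using e(2) card_intersecting_edges[OF GV(1) _ GV(2) e(1)] r unfolding D_def G(2) by linarith
    then have "?m div k < r * (D - 1) + 1" by simp
    also have "\<dots> \<le> r * D" using D0 r by (cases D) auto
    finally have "?m < k * (r * D)" using k by (simp add: div_less_iff_less_mult mult.commute)
    then have "N * ?m < N * (k * (r * D))" using N0 by simp
    also have "\<dots> = k * r * (N * D)" by (simp add: mult_ac)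
    also have "\<dots> \<le> k * r * ?C" using ND by simp
    finally have Nm: "N * ?m < k * r * ?C" .
    obtain \<Q> where Q: "matching_packing k ?E \<Q>" "\<And>M. M \<subseteq> ?E - \<Union>\<Q> \<Longrightarrow> disjoint M \<Longrightarrow> card M < k"
      using exists_maximal_matching_packing[OF finE k] by blast
    note pack = matching_packing_card[OF Q(1) finE]
    define R where "R = card (?E - \<Union>\<Q>)"
    have "?m = k * card \<Q> + R"
      using pack(1) card_Diff_subset[OF finite_subset[OF pack(2) finE] pack(2)] card_mono[OF finE pack(2)]
      unfolding R_def by linarith
    moreover have "phi_graph H G \<le> card \<Q> + R" using phi_graph_le[OF G(1) H k Q(1)] unfolding R_def .
    then have "k * phi_graph H G \<le> k * (card \<Q> + R)" by simp
    \<comment> \<open>In \<open>k\<close> times the number of parts, a packed edge counts once and a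
      remaining edge \<open>k\<close> times, hence the surplus \<open>(k - 1) * R\<close> over
      \<open>?m\<close>.\<close>
    moreover have "k * R = R + (k - 1) * R" using k by (cases k) auto
    ultimately have "k * phi_graph H G \<le> ?m + (k - 1) * R" by (simp add: add_mult_distrib2)
    then have "N * (k * phi_graph H G) \<le> N * (?m + (k - 1) * R)" by simp
    also have "\<dots> = N * ?m + (k - 1) * (N * R)" by (simp add: algebra_simps)
    also have "\<dots> < k * r * ?C + (k - 1) * ((k - 1) * ?C)"
    proof (rule add_less_le_mono[OF Nm])
      have "N * R \<le> (k - 1) * ?C"
        using card_no_matching[OF GV(1), of r "?E - \<Union>\<Q>" k] Q(2) GV(2) r unfolding N_def R_def G(2) by auto
      then show "(k - 1) * (N * R) \<le> (k - 1) * ((k - 1) * ?C)" by simp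
    qed
    also have "\<dots> = (k * r + (k - 1) * (k - 1)) * ?C" by (simp add: algebra_simps)
    also have "\<dots> \<le> N * ?C" using N_ge by (rule mult_right_mono) simp
    finally have "k * phi_graph H G < ?C" by simp
    then show ?thesis ..
  qed
qed

section \<open>Arithmetic of the extremal value\<close>

definition extremal_value :: "nat \<Rightarrow> nat \<Rightarrow> nat" where
  "extremal_value k C = (if C mod k = k - 1 then C div k + k - 1 else C div k + k - 2)"

text \<open>The distance from \<open>C\<close> down to the nearest number with remainder
  \<open>k - 1\<close>; an explicit form of \<open>deleted_count\<close>.\<close>

definition missing_edges :: "nat \<Rightarrow> nat \<Rightarrow> nat" where
  "missing_edges k C = (if C mod k = k - 1 then 0 else C mod k + 1)"

text \<open>Write \<open>C = Q * k + j\<close> and \<open>m = q * k + s\<close>. For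
  \<open>q = Q\<close> the sum is at most \<open>Q + j\<close>; for \<open>q < Q\<close> it is at
  most \<open>(Q - 1) + (k - 1)\<close>, attained only at \<open>q = Q - 1\<close> and
  \<open>s = k - 1\<close>, a point that exists because \<open>k \<le> C\<close> gives
  \<open>Q \<ge> 1\<close>. The two candidates tie exactly for \<open>j = k - 2\<close>, where the
  complete graph becomes extremal too. For \<open>k = 1\<close> both alternatives of the equality
  case say \<open>m = C\<close>.\<close>

lemma extremal_value_bounds:
  assumes k: "k \<ge> 1" and C: "k \<le> C" and m: "m \<le> C"
  shows "m div k + m mod k \<le> extremal_value k C"
    and "m div k + m mod k = extremal_value k C \<longleftrightarrow>
      m = C - missing_edges k C \<or> (k = 1 \<or> C mod k + 2 = k) \<and> m = C"
    and "C \<le> k * extremal_value k C"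
    and "missing_edges k C \<le> C"
proof -
  define Q j q s where "Q = C div k" and "j = C mod k" and "q = m div k" and "s = m mod k"
  have Cm: "C = Q * k + j" "m = q * k + s" unfolding Q_def j_def q_def s_def by simp_all
  have lt: "j < k" "s < k" using k unfolding j_def s_def by simp_all
  have Q1: "1 \<le> Q" using C k unfolding Q_def by (simp add: less_eq_div_iff_mult_less_eq)
  have qQ: "q \<le> Q" unfolding q_def Q_def using m by (rule div_le_mono)
  obtain Q' where Q': "Q = Suc Q'" using Q1 by (cases Q) auto
  have le: "q = Q \<Longrightarrow> s \<le> j" using m Cm by simp
  have eq_iff: "m = x * k + y \<longleftrightarrow> q = x \<and> s = y" if "y < k" for x y
    using that unfolding q_def s_def by (auto simp: mult.commute)
  show mis: "missing_edges k C \<le> C"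
    using lt Cm Q' unfolding missing_edges_def j_def[symmetric] by simp
  show "C \<le> k * extremal_value k C"
  proof (cases "j = k - 1")
    case True
    then have "k * extremal_value k C = Q * k + k * (k - 1)"
      using k unfolding extremal_value_def j_def[symmetric] Q_def[symmetric] by (simp add: algebra_simps)
    moreover have "k - 1 \<le> k * (k - 1)" using k by simp
    ultimately show ?thesis using Cm(1) True by linarith
  next
    case False
    then have k2: "2 \<le> k" using lt(1) by linarith
    then have "k * extremal_value k C = Q * k + k * (k - 2)"
      using False unfolding extremal_value_def j_def[symmetric] Q_def[symmetric]
      by (simp add: algebra_simps add_mult_distrib2[symmetric])
    moreover have "k - 2 \<le> k * (k - 2)" using k by simp
    ultimately show ?thesis using Cm(1) False lt(1) by linarith
  qed
  have both: "q + s \<le> extremal_value k C \<and>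
    (q + s = extremal_value k C \<longleftrightarrow> m = C - missing_edges k C \<or> (k = 1 \<or> j + 2 = k) \<and> m = C)"
  proof (cases "j = k - 1")
    case True
    have "m = C \<longleftrightarrow> q = Q \<and> s = k - 1" using eq_iff[of "k - 1" Q] k Cm(1) True by simp
    then show ?thesis
      using True qQ lt(2) k unfolding extremal_value_def missing_edges_def j_def[symmetric] Q_def[symmetric]
      by auto
  next
    case False
    then have k2: "2 \<le> k" "j + 2 \<le> k" using lt(1) by linarith+
    have "C - missing_edges k C = Q' * k + (k - 1)"
      using False Cm(1) Q' k2 unfolding missing_edges_def j_def[symmetric] by simp
    then have 1: "m = C - missing_edges k C \<longleftrightarrow> q = Q' \<and> s = k - 1" using eq_iff[of "k - 1" Q'] k by simp
    have 2: "m = C \<longleftrightarrow> q = Q \<and> s = j" using eq_iff[of j Q] lt(1) Cm(1) by simp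
    have T: "extremal_value k C = Q + k - 2"
      using False unfolding extremal_value_def j_def[symmetric] Q_def[symmetric] by simp
    show ?thesis unfolding 1 2 T using k2 lt le qQ Q' by (cases "q = Q") auto
  qed
  show "m div k + m mod k \<le> extremal_value k C" using both unfolding q_def s_def by blast
  show "m div k + m mod k = extremal_value k C \<longleftrightarrow>
      m = C - missing_edges k C \<or> (k = 1 \<or> C mod k + 2 = k) \<and> m = C"
    using both unfolding q_def s_def j_def by blast
qed

section \<open>The conditions in the characterisation of extremal graphs\<close>

lemma cong_minus_1_iff:
  assumes "k \<ge> 1"
  shows "[int C = int k - 1] (mod int k) \<longleftrightarrow> C mod k = k - 1"
proof -
  have "int k - 1 = int (k - 1)" using assms by simp
  then have "[int C = int k - 1] (mod int k) \<longleftrightarrow> [C = k - 1] (mod k)" by (simp only: cong_int_iff)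
  then show ?thesis using assms by (simp add: cong_def)
qed

text \<open>Modulo 1 every congruence holds, hence the separate case \<open>k = 1\<close>.\<close>

lemma cong_minus_2_iff:
  assumes "k \<ge> 1"
  shows "[int C = int k - 2] (mod int k) \<longleftrightarrow> k = 1 \<or> C mod k + 2 = k"
proof (cases "k = 1")
  case False
  then have k: "2 \<le> k" using assms by simp
  then have "int k - 2 = int (k - 2)" by simp
  then have "[int C = int k - 2] (mod int k) \<longleftrightarrow> [C = k - 2] (mod k)" by (simp only: cong_int_iff)
  then show ?thesis using k by (auto simp: cong_def)
qed (simp add: cong_def)

lemma deleted_count_eq:
  assumes k: "k \<ge> 1"
  shows "deleted_count r n k = missing_edges k (n choose r)"
proof -
  let ?C = "n choose r"
  have "?C mod k < k" using k by simp
  then have "missing_edges k ?C \<le> k - 1" unfolding missing_edges_def by auto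
  moreover have "[int ?C - int (missing_edges k ?C) = int k - 1] (mod int k)"
  proof (cases "?C mod k = k - 1")
    case True
    then show ?thesis using cong_minus_1_iff[OF k] by (simp add: missing_edges_def)
  next
    case False
    have "int ?C = int k * int (?C div k) + int (?C mod k)"
      by (metis mult_div_mod_eq of_nat_add of_nat_mult)
    then have "int ?C - int (missing_edges k ?C) - (int k - 1) = int k * (int (?C div k) - 1)"
      using False by (simp add: missing_edges_def algebra_simps)
    then show ?thesis by (metis cong_iff_dvd_diff dvd_triv_left)
  qed
  ultimately show ?thesis
    unfolding deleted_count_def using deleted_count_ex1[OF k] by (intro the1_equality) auto
qed

text \<open>Any choice of deleted edges is allowed, so membership depends on the number of edges
  alone.\<close>

lemma K_family_iff:
  assumes "k \<ge> 1" "r_graph r G" "card (verts G) = n" "missing_edges k (n choose r) \<le> n choose r"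
  shows "G \<in> K_family r n k \<longleftrightarrow> card (edges G) = (n choose r) - missing_edges k (n choose r)"
proof -
  let ?C = "n choose r" and ?l = "missing_edges k (n choose r)"
  have G: "finite (verts G)" "edges G \<subseteq> nsets (verts G) r" using assms(2) by (auto simp: r_graph_def)
  have fin: "finite (nsets (verts G) r)" using G(1) by (rule finite_imp_finite_nsets)
  show ?thesis
  proof
    assume "G \<in> K_family r n k"
    then obtain V D where V: "finite V" "card V = n" "D \<subseteq> nsets V r" "card D = ?l" "G = Hypergraph V (nsets V r - D)"
      using deleted_count_eq[OF assms(1)] by (auto simp: K_family_def complete_rgraph_def)
    have "finite D" using V(1,3) finite_imp_finite_nsets finite_subset by blast
    then show "card (edges G) = ?C - ?l" using V by (simp add: card_Diff_subset)
  next
    assume m: "card (edges G) = ?C - ?l"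
    let ?D = "nsets (verts G) r - edges G"
    have "card ?D = ?l" using m G fin assms(3,4) finite_subset[OF G(2) fin] by (simp add: card_Diff_subset)
    moreover have "G = Hypergraph (verts G) (nsets (verts G) r - ?D)"
      using G(2) by (cases G) auto
    ultimately show "G \<in> K_family r n k"
      using G(1) assms(3) deleted_count_eq[OF assms(1)] unfolding K_family_def complete_rgraph_def
      by (intro CollectI exI[of _ "verts G"] exI[of _ ?D]) auto
  qed
qed

lemma complete_iff:
  assumes "r_graph r G" "card (verts G) = n"
  shows "G = complete_rgraph r (verts G) \<longleftrightarrow> card (edges G) = n choose r"
proof -
  have G: "finite (verts G)" "edges G \<subseteq> nsets (verts G) r" using assms(1) by (auto simp: r_graph_def)
  have fin: "finite (nsets (verts G) r)" using G(1) by (rule finite_imp_finite_nsets)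
  have "card (edges G) = n choose r \<longleftrightarrow> edges G = nsets (verts G) r"
    using card_subset_eq[OF fin G(2)] assms(2) by auto
  also have "\<dots> \<longleftrightarrow> G = complete_rgraph r (verts G)" by (cases G) (auto simp: complete_rgraph_def)
  finally show ?thesis by simp
qed

lemma diff_le_choose: "n - r \<le> n choose Suc r"
proof (induction n)
  case (Suc n)
  show ?case
  proof (cases "r \<le> n")
    case True
    then have "1 \<le> n choose r" by (simp add: Suc_le_eq)
    then show ?thesis using Suc True by simp
  qed simp
qed simp

text \<open>This makes the quotient of \<open>n choose r\<close> by \<open>k\<close> positive, as
  \<open>extremal_value_bounds\<close> requires.\<close>

lemma le_choose_of_large:
  assumes "k \<ge> 1" "r \<ge> 2" "n \<ge> k * r * (k + r - 2) + 2 * r - 1"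
  shows "k \<le> n choose r"
proof -
  have "k * 1 \<le> k * (r * (k + r - 2))" using assms(1,2) by (intro mult_left_mono) auto
  then have "k \<le> k * r * (k + r - 2)" by (simp only: mult.assoc mult_1_right)
  then have "k \<le> n - (r - 1)" using assms(2,3) by linarith
  also have "\<dots> \<le> n choose r" using diff_le_choose[of n "r - 1"] assms(2) by simp
  finally show ?thesis .
qed

lemma
  fixes G :: "'a hypergraph"
  assumes large: "k \<ge> 1" "r \<ge> 2" "independent_edges r k H" "n \<ge> k * r * (k + r - 2) + 2 * r - 1"
    and G: "r_graph r G" "card (verts G) = n"
  shows phi_graph_le_extremal_value: "phi_graph H G \<le> extremal_value k (n choose r)"
    and phi_graph_eq_extremal_value_iff: "phi_graph H G = extremal_value k (n choose r) \<longleftrightarrow>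
      card (edges G) = (n choose r) - missing_edges k (n choose r) \<or>
      (k = 1 \<or> (n choose r) mod k + 2 = k) \<and> card (edges G) = n choose r"
proof -
  let ?m = "card (edges G)" and ?C = "n choose r" and ?T = "extremal_value k (n choose r)"
  have "finite (nsets (verts G) r)" using G(1) by (simp add: r_graph_def finite_imp_finite_nsets)
  then have m: "?m \<le> ?C" using G card_mono[of "nsets (verts G) r" "edges G"] by (simp add: r_graph_def)
  note bounds = extremal_value_bounds[OF large(1) le_choose_of_large[OF large(1,2,4)] m]
  \<comment> \<open>In the sparse alternative \<open>?C \<le> k * ?T\<close> puts
    \<open>phi_graph H G\<close> strictly below \<open>?T\<close>, and the general lower bound puts
    \<open>?m div k + ?m mod k\<close> below \<open>?T\<close> as well. So in both alternatives the
    number of edges decides equality.\<close>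
  have "phi_graph H G \<le> ?T \<and> (phi_graph H G = ?T \<longleftrightarrow> ?m div k + ?m mod k = ?T)"
    using phi_graph_dichotomy[OF large G]
  proof
    assume "k * phi_graph H G < ?C"
    then have "k * phi_graph H G < k * ?T" using bounds(3) by linarith
    then have "phi_graph H G < ?T" by simp
    then show ?thesis using phi_graph_ge[OF G(1) large(3,1)] by linarith
  qed (use bounds(1) in auto)
  then show "phi_graph H G \<le> ?T" "phi_graph H G = ?T \<longleftrightarrow>
      ?m = ?C - missing_edges k ?C \<or> (k = 1 \<or> ?C mod k + 2 = k) \<and> ?m = ?C"
    using bounds(2) by auto
qed

theorem theorem1p2:
  fixes k r n :: nat and H :: "'b hypergraph"
  assumes "k \<ge> 1" and "r \<ge> 2"
    and "independent_edges r k H"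
    and "n \<ge> k * r * (k + r - 2) + 2 * r - 1"
  shows "int (phi r H n) =
           (if [int (n choose r) = int k - 1] (mod int k)
            then \<lfloor>1 / real k * real (n choose r)\<rfloor> + int k - 1
            else \<lfloor>1 / real k * real (n choose r)\<rfloor> + int k - 2)
       \<and> (\<forall>G :: 'a hypergraph. r_graph r G \<and> card (verts G) = n \<longrightarrow>
           (extremal_graph r H n G \<longleftrightarrow>
              G \<in> K_family r n k \<or>
              ([int (n choose r) = int k - 2] (mod int k) \<and> G = complete_rgraph r (verts G))))"
proof -
  let ?C = "n choose r" and ?T = "extremal_value k (n choose r)" and ?l = "missing_edges k (n choose r)"
  have kC: "k \<le> ?C" using assms(1,2,4) by (rule le_choose_of_large)
  have l: "?l \<le> ?C" using extremal_value_bounds(4)[OF assms(1) kC order_refl] .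
  note le_T = phi_graph_le_extremal_value[OF assms] and eq_T = phi_graph_eq_extremal_value_iff[OF assms]
  have phi: "phi r H n = ?T"
    unfolding phi_def
  proof (rule Max_eqI)
    let ?S = "{phi_graph H G |G :: nat hypergraph. r_graph r G \<and> card (verts G) = n}"
    show le: "y \<le> ?T" if "y \<in> ?S" for y using that le_T by auto
    then show "finite ?S" by (meson finite_nat_set_iff_bounded_le)
    \<comment> \<open>Any \<open>?l\<close> edges may be deleted from the complete graph on
      \<open>{..<n}\<close>. The witness lives on natural numbers because \<open>phi\<close> does,
      whereas the bounds hold for every vertex type and so also apply to graphs over
      \<open>'a\<close>.\<close>
    obtain D where D: "D \<subseteq> nsets {..<n} r" "card D = ?l" "finite D"
      using obtain_subset_with_card_n[of ?l "nsets {..<n} r"] l by auto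
    define G where "G = Hypergraph {..<n} (nsets {..<n} r - D)"
    have G: "r_graph r G" "card (verts G) = n" by (auto simp: G_def r_graph_def)
    have "card (edges G) = ?C - ?l" using D by (simp add: G_def card_Diff_subset)
    then have "phi_graph H G = ?T" using eq_T[OF G] by simp
    then show "?T \<in> ?S" using G by (intro CollectI exI[of _ G]) simp
  qed
  have "\<lfloor>1 / real k * real ?C\<rfloor> = int (?C div k)"
    using floor_divide_of_nat_eq[of ?C k] by simp
  \<comment> \<open>The case \<open>k = 1\<close> never reaches the second branch, so subtracting 2
    there is not truncated.\<close>
  moreover have "?C mod k \<noteq> k - 1 \<Longrightarrow> 2 \<le> k" using assms(1) by (cases "k = 1") auto
  ultimately have "int ?T = (if [int ?C = int k - 1] (mod int k)
      then \<lfloor>1 / real k * real ?C\<rfloor> + int k - 1 else \<lfloor>1 / real k * real ?C\<rfloor> + int k - 2)"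
    using assms(1) cong_minus_1_iff[OF assms(1), of ?C] by (auto simp: extremal_value_def of_nat_diff)
  moreover have "extremal_graph r H n G \<longleftrightarrow> G \<in> K_family r n k \<or>
      ([int ?C = int k - 2] (mod int k) \<and> G = complete_rgraph r (verts G))"
    if G: "r_graph r G" "card (verts G) = n" for G :: "'a hypergraph"
    using eq_T[OF G] G phi unfolding K_family_iff[OF assms(1) G l] complete_iff[OF G]
      cong_minus_2_iff[OF assms(1)] extremal_graph_def by simp
  ultimately show ?thesis using phi by simp
qed

end
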